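(* Let $\Gamma$ be a countable non-amenable group. There exists $\delta > 0$ such that $$\liminf_{n \to \infty} \frac{\gamma_{L(\Gamma)}(E_n)}{n^{1/2-\delta}} = 0.$$
   Context: $L(\Gamma) \subset B(\ell^2\Gamma)$ is the group von Neumann algebra of the discrete group $\Gamma$, with its natural operator space structure. Let $\mathbb{F}_n$ be the free group on generators $g_1,\dots,g_n$, $C^*_{\rm red}(\mathbb{F}_n) \subset B(\ell^2\mathbb{F}_n)$ its reduced group $C^*$-algebra and $\lambda$ its left-regular representation. $E_n$ denotes the operator space spanned by $\lambda(g_1),\dots,\lambda(g_n)$ in $C^*_{\rm red}(\mathbb{F}_n)$. For any operator space $F$, set $$\gamma_F(E_n) := \inf \|u\|_{\rm cb}\|v\|_{\rm cb},$$ where the infimum is taken over all factorizations $E_n \stackrel{u}{\to} F \stackrel{v}{\to} E_n$ of the identity $\mathrm{id} \colon E_n \to E_n$ (i.e. $u,v$ are completely bounded linear maps with $v \circ u = \mathrm{id}_{E_n}$), and $\|\cdot\|_{\rm cb}$ is the completely bounded norm. *)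

theory Defs
  imports "HOL-Analysis.Analysis" "HOL-Algebra.Coset"
begin

section \<open>Bounded operators on $\ell^2(X)$\<close>

text \<open>
  A vector of $\ell^2(X)$ is a function on the ambient type that vanishes off \<open>X\<close>.
\<close>

definition ell2 :: "'x set \<Rightarrow> ('x \<Rightarrow> complex) set" where
  "ell2 X = {\<xi>. (\<forall>x. x \<notin> X \<longrightarrow> \<xi> x = 0) \<and> (\<lambda>x. (cmod (\<xi> x))\<^sup>2) summable_on UNIV}"

definition ell2_norm :: "('x \<Rightarrow> complex) \<Rightarrow> real" where
  "ell2_norm \<xi> = sqrt (\<Sum>\<^sub>\<infinity>x. (cmod (\<xi> x))\<^sup>2)"

type_synonym 'x op = "('x \<Rightarrow> complex) \<Rightarrow> ('x \<Rightarrow> complex)"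

definition op_norm :: "'x set \<Rightarrow> 'x op \<Rightarrow> ennreal" where
  "op_norm X T = (SUP \<xi> \<in> {\<xi> \<in> ell2 X. ell2_norm \<xi> \<le> 1}. ennreal (ell2_norm (T \<xi>)))"

text \<open>
  The algebra $B(\ell^2(X))$. Operators are required to vanish off \<open>ell2 X\<close>, so that equality of
  operators is equality of HOL functions; sums, scalar multiples and compositions preserve this.
\<close>

definition bounded_ops :: "'x set \<Rightarrow> 'x op set" where
  "bounded_ops X = {T.
     (\<forall>\<xi> \<in> ell2 X. T \<xi> \<in> ell2 X) \<and>
     (\<forall>\<xi> \<in> ell2 X. \<forall>\<eta> \<in> ell2 X. \<forall>a b.
        T (\<lambda>x. a * \<xi> x + b * \<eta> x) = (\<lambda>x. a * T \<xi> x + b * T \<eta> x)) \<and>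
     op_norm X T < \<infinity> \<and>
     (\<forall>\<xi>. \<xi> \<notin> ell2 X \<longrightarrow> T \<xi> = (\<lambda>_. 0))}"

definition commutant :: "'x set \<Rightarrow> 'x op set \<Rightarrow> 'x op set" where
  "commutant X A = {T \<in> bounded_ops X. \<forall>S \<in> A. T \<circ> S = S \<circ> T}"


section \<open>Completely bounded maps and factorization constants\<close>

text \<open>
  An operator space is represented by a set \<open>X\<close> and a linear subspace \<open>E\<close> of \<open>bounded_ops X\<close>.
  Its matrix norms come from the identification of $M_m(B(\ell^2(X)))$ with
  $B(\ell^2(X)^m) = B(\ell^2(X \times \{0,\dots,m-1\}))$: the operator matrix $(x_{ij})$
  sends $(\xi_j)_j$ to $(\sum_j x_{ij} \xi_j)_i$.
\<close>

definition mat_op :: "nat \<Rightarrow> (nat \<Rightarrow> nat \<Rightarrow> 'x op) \<Rightarrow> ('x \<times> nat) op" where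
  "mat_op m x \<xi> = (\<lambda>(a, i). if i < m then \<Sum>j<m. x i j (\<lambda>b. \<xi> (b, j)) a else 0)"

definition mat_norm :: "'x set \<Rightarrow> nat \<Rightarrow> (nat \<Rightarrow> nat \<Rightarrow> 'x op) \<Rightarrow> ennreal" where
  "mat_norm X m x = op_norm (X \<times> {..<m}) (mat_op m x)"

definition linear_map_on :: "'x op set \<Rightarrow> ('x op \<Rightarrow> 'y op) \<Rightarrow> bool" where
  "linear_map_on E u \<longleftrightarrow> (\<forall>S \<in> E. \<forall>T \<in> E. \<forall>a b.
     u (\<lambda>\<xi> x. a * S \<xi> x + b * T \<xi> x) = (\<lambda>\<xi> y. a * u S \<xi> y + b * u T \<xi> y))"

definition cb_norm :: "'x set \<Rightarrow> 'x op set \<Rightarrow> 'y set \<Rightarrow> ('x op \<Rightarrow> 'y op) \<Rightarrow> ennreal" where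
  "cb_norm X E Y u =
     (SUP m \<in> {1..}. SUP x \<in> {x. (\<forall>i<m. \<forall>j<m. x i j \<in> E) \<and> mat_norm X m x \<le> 1}.
        mat_norm Y m (\<lambda>i j. u (x i j)))"

definition cb_maps :: "'x set \<Rightarrow> 'x op set \<Rightarrow> 'y set \<Rightarrow> 'y op set \<Rightarrow> ('x op \<Rightarrow> 'y op) set" where
  "cb_maps X E Y F = {u. u \<in> E \<rightarrow> F \<and> linear_map_on E u \<and> cb_norm X E Y u < \<infinity>}"

text \<open>
  The constant $\gamma_F(E)$ for $F \subseteq B(\ell^2(Y))$ and $E \subseteq B(\ell^2(X))$;
  its value is \<open>\<infinity>\<close> if the identity of \<open>E\<close> does not factor through \<open>F\<close>.
\<close>

definition factorization_const :: "'y set \<Rightarrow> 'y op set \<Rightarrow> 'x set \<Rightarrow> 'x op set \<Rightarrow> ennreal" where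
  "factorization_const Y F X E =
     (INF (u, v) \<in> {(u, v). u \<in> cb_maps X E Y F \<and> v \<in> cb_maps Y F X E \<and> (\<forall>T \<in> E. v (u T) = T)}.
        cb_norm X E Y u * cb_norm Y F X v)"


section \<open>Group von Neumann algebras and amenability\<close>

definition left_regular :: "('g, 'b) monoid_scheme \<Rightarrow> 'g \<Rightarrow> 'g op" where
  "left_regular G g \<xi> =
     (if \<xi> \<in> ell2 (carrier G)
      then (\<lambda>x. if x \<in> carrier G then \<xi> (inv\<^bsub>G\<^esub> g \<otimes>\<^bsub>G\<^esub> x) else 0)
      else (\<lambda>_. 0))"

definition group_vN_algebra :: "('g, 'b) monoid_scheme \<Rightarrow> 'g op set" where
  "group_vN_algebra G =
     commutant (carrier G) (commutant (carrier G) (left_regular G ` carrier G))"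

text \<open>
  Amenability is the existence of a left-invariant mean on the bounded real functions on the
  group. By linearity and positivity, \<open>M f\<close> depends only on the values of \<open>f\<close> on \<open>carrier G\<close>.
\<close>

definition amenable :: "('g, 'b) monoid_scheme \<Rightarrow> bool" where
  "amenable G \<longleftrightarrow> (\<exists>M :: ('g \<Rightarrow> real) \<Rightarrow> real.
     (\<forall>f h a b. bounded (f ` carrier G) \<longrightarrow> bounded (h ` carrier G) \<longrightarrow>
        M (\<lambda>x. a * f x + b * h x) = a * M f + b * M h) \<and>
     (\<forall>f. bounded (f ` carrier G) \<longrightarrow> (\<forall>x \<in> carrier G. 0 \<le> f x) \<longrightarrow> 0 \<le> M f) \<and>
     M (\<lambda>_. 1) = 1 \<and>
     (\<forall>f. \<forall>g \<in> carrier G. bounded (f ` carrier G) \<longrightarrow>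
        M (\<lambda>x. f (inv\<^bsub>G\<^esub> g \<otimes>\<^bsub>G\<^esub> x)) = M f))"


section \<open>Free groups and the spaces $E_n$\<close>

text \<open>
  The free group on \<open>n\<close> generators is realized by reduced words: \<open>(i, True)\<close> stands for the
  generator with index \<open>i < n\<close> and \<open>(i, False)\<close> for its inverse.
\<close>

type_synonym letter = "nat \<times> bool"

definition inv_letter :: "letter \<Rightarrow> letter" where
  "inv_letter x = (fst x, \<not> snd x)"

definition reduced :: "letter list \<Rightarrow> bool" where
  "reduced = successively (\<lambda>x y. y \<noteq> inv_letter x)"

fun push_letter :: "letter \<Rightarrow> letter list \<Rightarrow> letter list" where
  "push_letter x [] = [x]"
| "push_letter x (y # w) = (if y = inv_letter x then w else x # y # w)"

definition free_group :: "nat \<Rightarrow> letter list monoid" where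
  "free_group n =
     \<lparr>carrier = {w. reduced w \<and> set w \<subseteq> {..<n} \<times> UNIV},
      monoid.mult = foldr push_letter,
      one = []\<rparr>"

abbreviation free_gen :: "nat \<Rightarrow> letter list" where
  "free_gen i \<equiv> [(i, True)]"

definition free_gen_span :: "nat \<Rightarrow> letter list op set" where
  "free_gen_span n =
     {T. \<exists>c :: nat \<Rightarrow> complex.
        T = (\<lambda>\<xi> w. \<Sum>i<n. c i * left_regular (free_group n) (free_gen i) \<xi> w)}"

definition gamma_vN :: "('g, 'b) monoid_scheme \<Rightarrow> nat \<Rightarrow> ennreal" where
  "gamma_vN G n =
     factorization_const (carrier G) (group_vN_algebra G)
       (carrier (free_group n)) (free_gen_span n)"


section \<open>Basic facts\<close>

lemma ell2_lincomb:
  assumes "\<xi> \<in> ell2 X" "\<eta> \<in> ell2 X"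
  shows "(\<lambda>x. a * \<xi> x + b * \<eta> x) \<in> ell2 X"
proof -
  have le: "(cmod (a * \<xi> x + b * \<eta> x))\<^sup>2
      \<le> 2 * (cmod a)\<^sup>2 * (cmod (\<xi> x))\<^sup>2 + 2 * (cmod b)\<^sup>2 * (cmod (\<eta> x))\<^sup>2" for x
  proof -
    have "cmod (a * \<xi> x + b * \<eta> x) \<le> cmod a * cmod (\<xi> x) + cmod b * cmod (\<eta> x)"
      using norm_triangle_ineq[of "a * \<xi> x" "b * \<eta> x"] by (simp add: norm_mult)
    then have "(cmod (a * \<xi> x + b * \<eta> x))\<^sup>2 \<le> (cmod a * cmod (\<xi> x) + cmod b * cmod (\<eta> x))\<^sup>2"
      by (rule power_mono) simp
    also have "\<dots> \<le> 2 * (cmod a * cmod (\<xi> x))\<^sup>2 + 2 * (cmod b * cmod (\<eta> x))\<^sup>2"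
      using sum_squares_bound[of "cmod a * cmod (\<xi> x)" "cmod b * cmod (\<eta> x)"]
      by (simp add: power2_sum)
    finally show ?thesis by (simp add: power_mult_distrib)
  qed
  have "(\<lambda>x. 2 * (cmod a)\<^sup>2 * (cmod (\<xi> x))\<^sup>2 + 2 * (cmod b)\<^sup>2 * (cmod (\<eta> x))\<^sup>2) summable_on UNIV"
    using assms by (intro summable_on_add summable_on_cmult_right) (auto simp: ell2_def)
  then have "(\<lambda>x. (cmod (a * \<xi> x + b * \<eta> x))\<^sup>2) summable_on UNIV"
    by (rule summable_on_comparison_test) (use le in auto)
  then show ?thesis using assms by (simp add: ell2_def)
qed

lemma inv_letter_inv_letter [simp]: "inv_letter (inv_letter x) = x"
  by (simp add: inv_letter_def)

lemma inv_letter_neq [simp]: "inv_letter x \<noteq> x" "x \<noteq> inv_letter x"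
  by (cases x; simp add: inv_letter_def)+

lemma reduced_Nil [simp]: "reduced []"
  by (simp add: reduced_def)

lemma reduced_Cons: "reduced (x # w) \<longleftrightarrow> (w = [] \<or> hd w \<noteq> inv_letter x) \<and> reduced w"
  by (cases w) (auto simp: reduced_def)

lemma reduced_push: "reduced w \<Longrightarrow> reduced (push_letter x w)"
  by (cases w) (auto simp: reduced_Cons)

lemma reduced_foldr_push: "reduced w \<Longrightarrow> reduced (foldr push_letter v w)"
  by (induction v) (auto intro: reduced_push)

lemma push_push_inv: "reduced w \<Longrightarrow> push_letter x (push_letter (inv_letter x) w) = w"
  by (cases w rule: list.exhaust; cases "tl w") (auto simp: reduced_Cons)

lemma foldr_push_push:
  assumes "reduced w"
  shows "foldr push_letter (push_letter x v) w = push_letter x (foldr push_letter v w)"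
  using assms push_push_inv[of _ x] by (cases v) (auto simp: reduced_foldr_push)

lemma foldr_push_assoc:
  assumes "reduced w"
  shows "foldr push_letter (foldr push_letter u v) w = foldr push_letter u (foldr push_letter v w)"
  using assms by (induction u) (auto simp: foldr_push_push)

lemma foldr_push_Nil: "reduced w \<Longrightarrow> foldr push_letter w [] = w"
proof (induction w)
  case (Cons x w)
  then show ?case by (cases w) (auto simp: reduced_Cons)
qed simp

lemma set_push: "set (push_letter x w) \<subseteq> insert x (set w)"
  by (cases w) auto

lemma set_foldr_push: "set (foldr push_letter v w) \<subseteq> set v \<union> set w"
  using set_push by (induction v) fastforce+

lemma foldr_push_inverse:
  assumes "reduced w"
  shows "foldr push_letter (foldr push_letter (map inv_letter (rev w)) []) w = []"
proof -
  have "foldr push_letter (map inv_letter (rev w)) w = []"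
    by (induction w) auto
  then show ?thesis
    using assms foldr_push_assoc[of w _ "[]"] by simp
qed

lemma group_free_group: "group (free_group n)"
proof (rule groupI)
  fix w assume w: "w \<in> carrier (free_group n)"
  let ?v = "foldr push_letter (map inv_letter (rev w)) []"
  have "set ?v \<subseteq> {..<n} \<times> UNIV"
    using w set_foldr_push[of "map inv_letter (rev w)" "[]"]
    by (fastforce simp: free_group_def inv_letter_def)
  then have "?v \<in> carrier (free_group n)"
    by (simp add: free_group_def reduced_foldr_push)
  with w show "\<exists>v \<in> carrier (free_group n). v \<otimes>\<^bsub>free_group n\<^esub> w = \<one>\<^bsub>free_group n\<^esub>"
    by (intro bexI[of _ ?v]) (simp_all add: free_group_def foldr_push_inverse)
next
  fix v w assume "v \<in> carrier (free_group n)" "w \<in> carrier (free_group n)"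
  then show "v \<otimes>\<^bsub>free_group n\<^esub> w \<in> carrier (free_group n)"
    using set_foldr_push[of v w] by (auto simp: free_group_def reduced_foldr_push)
qed (auto simp: free_group_def foldr_push_assoc)

lemma left_regular_in_bounded_ops:
  assumes "group G" and g: "g \<in> carrier G"
  shows "left_regular G g \<in> bounded_ops (carrier G)"
proof -
  interpret group G by fact
  let ?t = "\<lambda>x. inv\<^bsub>G\<^esub> g \<otimes>\<^bsub>G\<^esub> x"
  have bij: "bij_betw ?t (carrier G) (carrier G)"
    by (rule bij_betwI[where g = "\<lambda>x. g \<otimes>\<^bsub>G\<^esub> x"]) (auto simp: g m_assoc[symmetric])
  have supp: "((\<lambda>x. (cmod (\<xi> x))\<^sup>2) summable_on UNIV) = ((\<lambda>x. (cmod (\<xi> x))\<^sup>2) summable_on carrier G)"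
    "(\<Sum>\<^sub>\<infinity>x. (cmod (\<xi> x))\<^sup>2) = (\<Sum>\<^sub>\<infinity>x\<in>carrier G. (cmod (\<xi> x))\<^sup>2)"
    if "\<forall>x. x \<notin> carrier G \<longrightarrow> \<xi> x = 0" for \<xi> :: "'a \<Rightarrow> complex"
    by (rule summable_on_cong_neutral infsum_cong_neutral; use that in auto)+
  have cl: "left_regular G g \<xi> \<in> ell2 (carrier G)"
    and norm: "ell2_norm (left_regular G g \<xi>) = ell2_norm \<xi>"
    if \<xi>: "\<xi> \<in> ell2 (carrier G)" for \<xi>
  proof -
    have eq: "(cmod (left_regular G g \<xi> x))\<^sup>2 = (cmod (\<xi> (?t x)))\<^sup>2" if "x \<in> carrier G" for x
      using that \<xi> by (simp add: left_regular_def)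
    have off: "\<forall>x. x \<notin> carrier G \<longrightarrow> left_regular G g \<xi> x = 0"
      by (simp add: left_regular_def)
    have off': "\<forall>x. x \<notin> carrier G \<longrightarrow> \<xi> x = 0"
      and "(\<lambda>x. (cmod (\<xi> x))\<^sup>2) summable_on UNIV"
      using \<xi> by (auto simp: ell2_def)
    then have "(\<lambda>x. (cmod (\<xi> x))\<^sup>2) summable_on carrier G"
      using supp(1) by blast
    then have "(\<lambda>x. (cmod (left_regular G g \<xi> x))\<^sup>2) summable_on carrier G"
      using summable_on_reindex_bij_betw[OF bij, of "\<lambda>x. (cmod (\<xi> x))\<^sup>2"]
      by (simp add: eq cong: summable_on_cong)
    then show "left_regular G g \<xi> \<in> ell2 (carrier G)"
      using off supp(1)[OF off] by (simp add: ell2_def)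
    have "(\<Sum>\<^sub>\<infinity>x\<in>carrier G. (cmod (left_regular G g \<xi> x))\<^sup>2) = (\<Sum>\<^sub>\<infinity>x\<in>carrier G. (cmod (\<xi> x))\<^sup>2)"
      using infsum_reindex_bij_betw[OF bij, of "\<lambda>x. (cmod (\<xi> x))\<^sup>2"]
      by (simp add: eq cong: infsum_cong)
    then show "ell2_norm (left_regular G g \<xi>) = ell2_norm \<xi>"
      unfolding ell2_norm_def using supp(2)[OF off] supp(2)[OF off'] by simp
  qed
  have lin: "left_regular G g (\<lambda>x. a * \<xi> x + b * \<eta> x)
      = (\<lambda>x. a * left_regular G g \<xi> x + b * left_regular G g \<eta> x)"
    if "\<xi> \<in> ell2 (carrier G)" "\<eta> \<in> ell2 (carrier G)" for \<xi> \<eta> a b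
    using that ell2_lincomb[OF that] by (auto simp: left_regular_def)
  have "op_norm (carrier G) (left_regular G g) \<le> 1"
    unfolding op_norm_def by (rule SUP_least) (auto simp: norm)
  then have "op_norm (carrier G) (left_regular G g) < \<infinity>"
    by (rule le_less_trans) simp
  then show ?thesis
    using cl lin by (auto simp: bounded_ops_def left_regular_def)
qed

lemma left_regular_in_group_vN_algebra:
  assumes "group G" "g \<in> carrier G"
  shows "left_regular G g \<in> group_vN_algebra G"
  using assms left_regular_in_bounded_ops[OF assms]
  by (auto simp: group_vN_algebra_def commutant_def)

end

theory Submission
  imports Defs
begin

text \<open>
  Write \<open>g\<^sub>1, \<dots>, g\<^sub>n\<close> for the free generators and let \<open>F \<subseteq> G\<close> be a set with \<open>n\<close> elements. Matching
  the generators with \<open>F\<close> by a bijection gives two maps between \<open>E\<^sub>n\<close> and the von Neumann algebra of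
  \<open>G\<close>: one sends \<open>\<lambda>(g\<^sub>i)\<close> to \<open>\<lambda>(s\<^sub>i)\<close>, where \<open>s\<^sub>i \<in> F\<close> corresponds to \<open>g\<^sub>i\<close>, and the other sends \<open>x\<close> to
  \<open>\<Sum>\<^sub>i x\<^sub>i \<lambda>(g\<^sub>i)\<close>, where \<open>x\<^sub>i\<close> is the Fourier coefficient of \<open>x\<close> at \<open>s\<^sub>i\<close>. Both have the same form, they
  read off Fourier coefficients on one group and resynthesize on the other, and they compose to the
  identity of \<open>E\<^sub>n\<close>. The proof bounds their completely bounded norms.

  A matrix over the von Neumann algebra of norm at most 1 has coefficient matrices \<open>a\<^sub>1, \<dots>, a\<^sub>n\<close> at
  \<open>F\<close> that form a contractive column and a contractive row (\<open>fourier_coeff_contr\<close>). It remains to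
  bound \<open>\<parallel>\<Sum>\<^sub>i \<lambda>(t\<^sub>i) \<otimes> a\<^sub>i\<parallel>\<close> for such families. In the free group the bound is 2, independently of \<open>n\<close>
  (\<open>haagerup_inequality\<close>). In any group it is \<open>\<parallel>\<Sum>\<^sub>i \<lambda>(s\<^sub>i)\<parallel>\<^sup>1\<^sup>/\<^sup>2\<close> (\<open>group_block_bound\<close>). This is a
  Cauchy--Schwarz inequality of Haagerup, and has an elementary proof here because the scalar operator
  \<open>\<Sum>\<^sub>i \<lambda>(s\<^sub>i)\<close> has a nonnegative kernel. One gets
  \<open>\<gamma>(E\<^sub>n) \<le> 2 \<parallel>\<Sum>\<^sub>i \<lambda>(s\<^sub>i)\<parallel>\<^sup>1\<^sup>/\<^sup>2\<close> (\<open>gamma_vN_le\<close>), which is \<open>2 n\<^sup>1\<^sup>/\<^sup>2\<close> at worst.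

  Non-amenability improves on the trivial bound \<open>\<parallel>\<Sum>\<^sub>i \<lambda>(s\<^sub>i)\<parallel> \<le> n\<close> by a power of \<open>n\<close>. By Kesten's
  theorem (\<open>kesten\<close>) some finite set \<open>S\<close> satisfies \<open>\<parallel>\<Sum>\<^sub>s\<^sub>\<in>\<^sub>S \<lambda>(s)\<parallel> \<le> r |S|\<close> with \<open>r < 1\<close>, so the number of
  ways to write an element as a product of \<open>k\<close> elements of \<open>S\<close> is a weight of total mass \<open>|S|\<^sup>k\<close>
  whose convolution operator has norm at most \<open>r\<^sup>k |S|\<^sup>k\<close>. The \<open>k\<close>-fold products need not be
  distinct, but the nonzero values of the weight lie between 1 and \<open>|S|\<^sup>k\<close>, so it has only \<open>O(k)\<close> dyadic levels and
  one of its level sets \<open>F\<close> carries a \<open>1/O(k)\<close> part of the mass (\<open>level_set\<close>). On it the weight is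
  constant up to a factor 2, which gives \<open>\<parallel>\<Sum>\<^sub>s\<^sub>\<in>\<^sub>F \<lambda>(s)\<parallel> \<le> O(k) r\<^sup>k |F|\<close>. As \<open>|F| \<le> |S|\<^sup>k\<close>, the factor
  \<open>O(k) r\<^sup>k\<close> is at most \<open>|F|\<^sup>-\<^sup>\<theta>\<close> for some fixed \<open>\<theta> > 0\<close> and all large \<open>k\<close>, and \<open>|F|\<close> tends to
  infinity with \<open>k\<close> because the norm on the left is at least 1 (\<open>small_norm_sets\<close>).

  All norm estimates are made for finite matrices; vectors with infinite support enter only through
  their restrictions to finite sets.
\<close>

section \<open>Finite quadratic sums\<close>

lemma L2_set_power2: "(L2_set f A)\<^sup>2 = (\<Sum>x\<in>A. (f x)\<^sup>2)"
  by (simp add: L2_set_def sum_nonneg)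

lemma L2_set_sum_le: "L2_set (\<lambda>x. \<Sum>t\<in>F. f t x) B \<le> (\<Sum>t\<in>F. L2_set (f t) B)"
proof (induction F rule: infinite_finite_induct)
  case (insert s F)
  then show ?case
    using L2_set_triangle_ineq[of "f s" "\<lambda>x. \<Sum>t\<in>F. f t x" B] by simp
qed (simp_all add: L2_set_def)

lemma L2_set_square_diff:
  "(\<Sum>x\<in>W. \<bar>(f x)\<^sup>2 - (g x)\<^sup>2\<bar>) \<le> L2_set (\<lambda>x. f x - g x) W * (L2_set f W + L2_set g W)"
  for f :: "'a \<Rightarrow> real"
proof -
  have "(\<Sum>x\<in>W. \<bar>(f x)\<^sup>2 - (g x)\<^sup>2\<bar>) = (\<Sum>x\<in>W. \<bar>f x - g x\<bar> * \<bar>f x + g x\<bar>)"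
    by (intro sum.cong refl) (simp add: abs_mult[symmetric] power2_eq_square algebra_simps)
  also have "\<dots> \<le> L2_set (\<lambda>x. f x - g x) W * L2_set (\<lambda>x. f x + g x) W"
    by (rule L2_set_mult_ineq)
  also have "\<dots> \<le> L2_set (\<lambda>x. f x - g x) W * (L2_set f W + L2_set g W)"
    by (intro mult_left_mono L2_set_triangle_ineq) simp
  finally show ?thesis .
qed

section \<open>Norms of Hermitian matrices from the growth of their powers\<close>

text \<open>
  The quotients \<open>c (p + 1) / c p\<close> of a log-convex sequence increase, so an exponential growth rate
  bounds the first of them, whatever the constant \<open>D\<close>.
\<close>
lemma log_convex_growth:
  fixes c :: "nat \<Rightarrow> real"
  assumes nonneg: "\<And>p. 0 \<le> c p"
    and convex: "\<And>p. (c (Suc p))\<^sup>2 \<le> c p * c (Suc (Suc p))"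
    and growth: "\<And>p. c p \<le> D * R ^ p"
    and R: "0 \<le> R"
  shows "c 1 \<le> R * c 0"
proof (rule ccontr)
  assume "\<not> c 1 \<le> R * c 0"
  then have gt: "R * c 0 < c 1" by simp
  then have c1: "0 < c 1" using R nonneg[of 0] by (smt (verit) mult_nonneg_nonneg)
  have c0: "0 < c 0"
  proof (rule ccontr)
    assume "\<not> 0 < c 0"
    then have "c 0 = 0" using nonneg[of 0] by simp
    then have "(c 1)\<^sup>2 \<le> 0" using convex[of 0] by simp
    then show False using c1 by simp
  qed
  define r where "r = c 1 / c 0"
  have r: "R < r" "0 < r" using gt c0 c1 by (simp_all add: r_def field_simps)
  have step: "0 < c p \<and> r * c p \<le> c (Suc p)" for p
  proof (induction p)
    case 0
    then show ?case using c0 by (simp add: r_def)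
  next
    case (Suc p)
    then have pos: "0 < c p" "0 < c (Suc p)" and le: "r * c p \<le> c (Suc p)"
      using r(2) by (auto intro: less_le_trans[OF mult_pos_pos])
    have "r * c (Suc p) * c p \<le> c (Suc p) * c (Suc p)"
      using mult_right_mono[OF le, of "c (Suc p)"] pos by (simp add: ac_simps)
    also have "\<dots> \<le> c (Suc (Suc p)) * c p"
      using convex[of p] by (simp add: power2_eq_square ac_simps)
    finally show ?case using pos by simp
  qed
  have lower: "c 0 * r ^ p \<le> c p" for p
  proof (induction p)
    case (Suc p)
    then have "c 0 * r ^ Suc p \<le> r * c p" using r by (simp add: ac_simps)
    then show ?case using step[of p] by simp
  qed simp
  show False
  proof (cases "R = 0")
    case True
    then show False using growth[of 1] c1 by simp
  next
    case False
    then have "0 < R" using R by simp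
    then have "1 < r / R" using r by simp
    then obtain p where "D / c 0 < (r / R) ^ p" using real_arch_pow by blast
    then have "D * R ^ p < c 0 * r ^ p"
      using c0 \<open>0 < R\<close> by (simp add: field_simps power_divide)
    then show False using lower[of p] growth[of p] by simp
  qed
qed

definition mat_apply :: "'i set \<Rightarrow> ('i \<Rightarrow> 'i \<Rightarrow> complex) \<Rightarrow> ('i \<Rightarrow> complex) \<Rightarrow> 'i \<Rightarrow> complex" where
  "mat_apply I H \<xi> i = (\<Sum>j\<in>I. H i j * \<xi> j)"

text \<open>
  For Hermitian \<open>H\<close> the sequence \<open>\<parallel>H\<^sup>p \<xi>\<parallel>\<close> is log-convex, because
  \<open>\<parallel>H\<^sup>p\<^sup>+\<^sup>1 \<xi>\<parallel>\<^sup>2 = \<langle>H\<^sup>p \<xi>, H\<^sup>p\<^sup>+\<^sup>2 \<xi>\<rangle>\<close>. A growth rate that is easier to find in another, equivalent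
  norm therefore already bounds the first step.
\<close>
lemma hermitian_norm_le_growth:
  assumes "finite I"
    and herm: "\<And>i j. i \<in> I \<Longrightarrow> j \<in> I \<Longrightarrow> H j i = cnj (H i j)"
    and growth: "\<And>p. L2_set (\<lambda>i. cmod ((mat_apply I H ^^ p) \<xi> i)) I \<le> D * R ^ p"
    and R: "0 \<le> R"
  shows "L2_set (\<lambda>i. cmod (mat_apply I H \<xi> i)) I \<le> R * L2_set (\<lambda>i. cmod (\<xi> i)) I"
proof -
  define \<eta> where "\<eta> p = (mat_apply I H ^^ p) \<xi>" for p
  define c where "c p = L2_set (\<lambda>i. cmod (\<eta> p i)) I" for p
  have Suc: "\<eta> (Suc p) i = (\<Sum>j\<in>I. H i j * \<eta> p j)" for p i
    by (simp add: \<eta>_def mat_apply_def)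
  have convex: "(c (Suc p))\<^sup>2 \<le> c p * c (Suc (Suc p))" for p
  proof -
    have "complex_of_real ((c (Suc p))\<^sup>2) = (\<Sum>i\<in>I. \<eta> (Suc p) i * cnj (\<eta> (Suc p) i))"
      unfolding c_def L2_set_power2 of_real_sum complex_norm_square ..
    also have "\<dots> = (\<Sum>i\<in>I. \<Sum>j\<in>I. H i j * \<eta> p j * cnj (\<eta> (Suc p) i))"
      by (subst Suc) (simp add: sum_distrib_right)
    also have "\<dots> = (\<Sum>j\<in>I. \<Sum>i\<in>I. H i j * \<eta> p j * cnj (\<eta> (Suc p) i))"
      by (rule sum.swap)
    also have "\<dots> = (\<Sum>j\<in>I. \<eta> p j * cnj (\<eta> (Suc (Suc p)) j))"
    proof (rule sum.cong[OF refl])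
      fix j assume j: "j \<in> I"
      have "(\<Sum>i\<in>I. H i j * \<eta> p j * cnj (\<eta> (Suc p) i)) = (\<Sum>i\<in>I. \<eta> p j * cnj (H j i * \<eta> (Suc p) i))"
        using herm[OF j] herm[OF _ j] by (intro sum.cong) (auto simp: algebra_simps)
      then show "(\<Sum>i\<in>I. H i j * \<eta> p j * cnj (\<eta> (Suc p) i)) = \<eta> p j * cnj (\<eta> (Suc (Suc p)) j)"
        by (simp add: Suc[of "Suc p"] sum_distrib_left)
    qed
    finally have "(c (Suc p))\<^sup>2 = cmod (\<Sum>j\<in>I. \<eta> p j * cnj (\<eta> (Suc (Suc p)) j))"
      by (metis norm_of_real abs_of_nonneg zero_le_power2)
    also have "\<dots> \<le> (\<Sum>j\<in>I. cmod (\<eta> p j) * cmod (\<eta> (Suc (Suc p)) j))"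
      by (rule order.trans[OF norm_sum]) (simp add: norm_mult)
    also have "\<dots> \<le> c p * c (Suc (Suc p))"
      unfolding c_def using L2_set_mult_ineq[of "\<lambda>j. cmod (\<eta> p j)" "\<lambda>j. cmod (\<eta> (Suc (Suc p)) j)" I] by simp
    finally show ?thesis .
  qed
  have "c 1 \<le> R * c 0"
    by (rule log_convex_growth[where D = D])
      (use convex growth R in \<open>auto simp: c_def \<eta>_def L2_set_nonneg\<close>)
  then show ?thesis by (simp add: c_def \<eta>_def)
qed

text \<open>
  Indices of weight 0 contribute nothing on either side, since division by 0 gives 0.
\<close>
lemma weighted_cauchy_schwarz:
  fixes z :: "'a \<Rightarrow> complex"
  assumes "\<And>i. i \<in> A \<Longrightarrow> 0 \<le> N i" "\<And>i. i \<in> A \<Longrightarrow> N i = 0 \<Longrightarrow> z i = 0"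
  shows "(cmod (\<Sum>i\<in>A. z i))\<^sup>2 \<le> (\<Sum>i\<in>A. N i) * (\<Sum>i\<in>A. (cmod (z i))\<^sup>2 / N i)"
proof -
  have "cmod (\<Sum>i\<in>A. z i) \<le> (\<Sum>i\<in>A. \<bar>sqrt (N i)\<bar> * \<bar>cmod (z i) / sqrt (N i)\<bar>)"
    by (rule order.trans[OF norm_sum], rule sum_mono) (use assms in force)
  also have "\<dots> \<le> L2_set (\<lambda>i. sqrt (N i)) A * L2_set (\<lambda>i. cmod (z i) / sqrt (N i)) A"
    by (rule L2_set_mult_ineq)
  finally have "(cmod (\<Sum>i\<in>A. z i))\<^sup>2
      \<le> (L2_set (\<lambda>i. sqrt (N i)) A * L2_set (\<lambda>i. cmod (z i) / sqrt (N i)) A)\<^sup>2"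
    by (rule power_mono) simp
  also have "\<dots> = (\<Sum>i\<in>A. N i) * (\<Sum>i\<in>A. (cmod (z i))\<^sup>2 / N i)"
    using assms(1) by (simp add: power_mult_distrib L2_set_power2 power_divide)
  finally show ?thesis .
qed

text \<open>
  An elementary case of Haagerup's Cauchy--Schwarz inequality, in which a scalar matrix \<open>E\<close> with entries
  0 and 1 records where \<open>H\<close> may have nonzero blocks. Put \<open>N\<^sub>p = E\<^sup>p 1\<close>. By Cauchy--Schwarz with weights \<open>N\<^sub>p\<close>
  and by contractivity of the block columns, the energy \<open>\<Sum>\<^sub>x \<parallel>(H\<^sup>p \<xi>)(x)\<parallel>\<^sup>2 / N\<^sub>p(x)\<close> does not increase
  with \<open>p\<close>; since \<open>N\<^sub>p\<close> is at most a constant times \<open>C\<^sup>p\<close>, this gives the growth \<open>\<parallel>H\<^sup>p \<xi>\<parallel>\<^sup>2 = O(C\<^sup>p)\<close>, and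
  hence \<open>\<parallel>H\<parallel> \<le> \<surd>C\<close>.
\<close>
lemma hermitian_block_bound:
  fixes H :: "'w \<times> nat \<Rightarrow> 'w \<times> nat \<Rightarrow> complex" and E :: "'w \<Rightarrow> 'w \<Rightarrow> bool"
  assumes W: "finite W" and C: "0 \<le> C"
    and herm: "\<And>p q. H q p = cnj (H p q)"
    and supp: "\<And>x y i j. \<not> E x y \<Longrightarrow> H (x, i) (y, j) = 0"
    and adj: "\<And>f h. (\<And>x. 0 \<le> f x) \<Longrightarrow> (\<And>x. 0 \<le> h x) \<Longrightarrow>
      (\<Sum>x\<in>W. \<Sum>y\<in>W. of_bool (E x y) * f x * h y) \<le> C * L2_set f W * L2_set h W"
    and col: "\<And>y v. y \<in> W \<Longrightarrow>
      (\<Sum>x\<in>W. \<Sum>i<m. (cmod (\<Sum>j<m. H (x, i) (y, j) * v j))\<^sup>2) \<le> (\<Sum>j<m. (cmod (v j))\<^sup>2)"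
  shows "(\<Sum>x\<in>W. \<Sum>i<m. (cmod (\<Sum>y\<in>W. \<Sum>j<m. H (x, i) (y, j) * \<xi> (y, j)))\<^sup>2)
    \<le> C * (\<Sum>y\<in>W. \<Sum>j<m. (cmod (\<xi> (y, j)))\<^sup>2)"
proof -
  let ?I = "W \<times> {..<m}"
  \<comment> \<open>The weights \<open>N\<^sub>p = E\<^sup>p 1\<close> count walks of length \<open>p\<close>.\<close>
  define N where "N = rec_nat (\<lambda>x. 1 :: real) (\<lambda>_ f x. \<Sum>y\<in>W. of_bool (E x y) * f y)"
  have N0: "N 0 x = 1" and NS: "N (Suc p) x = (\<Sum>y\<in>W. of_bool (E x y) * N p y)" for p x
    by (simp_all add: N_def)
  have Nnn: "0 \<le> N p x" for p x
    by (induction p arbitrary: x) (auto simp: N0 NS intro!: sum_nonneg)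
  have NL2: "L2_set (N p) W \<le> C ^ p * sqrt (card W)" for p
  proof (induction p)
    case 0
    then show ?case by (simp add: N0 L2_set_def)
  next
    case (Suc p)
    have "(L2_set (N (Suc p)) W)\<^sup>2 = (\<Sum>x\<in>W. \<Sum>y\<in>W. of_bool (E x y) * N (Suc p) x * N p y)"
    proof -
      have "(N (Suc p) x)\<^sup>2 = (\<Sum>y\<in>W. of_bool (E x y) * N (Suc p) x * N p y)" for x
      proof -
        have "(N (Suc p) x)\<^sup>2 = N (Suc p) x * (\<Sum>y\<in>W. of_bool (E x y) * N p y)"
          by (simp only: NS[symmetric] power2_eq_square)
        then show ?thesis by (simp only: sum_distrib_left mult.assoc mult.left_commute)
      qed
      then show ?thesis by (simp only: L2_set_power2)
    qed
    also have "\<dots> \<le> C * L2_set (N (Suc p)) W * L2_set (N p) W"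
      by (rule adj) (auto simp: Nnn)
    finally have "L2_set (N (Suc p)) W \<le> C * L2_set (N p) W"
      using L2_set_nonneg[of "N (Suc p)" W] C L2_set_nonneg[of "N p" W]
      by (cases "L2_set (N (Suc p)) W = 0") (auto simp: power2_eq_square)
    also have "\<dots> \<le> C * (C ^ p * sqrt (card W))"
      using Suc C by (intro mult_left_mono) auto
    finally show ?case by simp
  qed
  have Nle: "N p x \<le> C ^ p * sqrt (card W)" if "x \<in> W" for p x
    using member_le_L2_set[OF W that, of "N p"] NL2[of p] by simp
  define \<eta> where "\<eta> p = (mat_apply ?I H ^^ p) \<xi>" for p
  have eta_Suc: "\<eta> (Suc p) (x, i) = (\<Sum>y\<in>W. \<Sum>j<m. H (x, i) (y, j) * \<eta> p (y, j))" for p x i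
    by (simp add: \<eta>_def mat_apply_def sum.cartesian_product)
  have zero: "\<eta> p (x, i) = 0" if "N p x = 0" for p x i
    using that
  proof (induction p arbitrary: x i)
    case (Suc p)
    have 0: "of_bool (E x y) * N p y = 0" if "y \<in> W" for y
      using Suc.prems that Nnn W by (simp add: NS sum_nonneg_eq_0_iff)
    have "H (x, i) (y, j) * \<eta> p (y, j) = 0" if "y \<in> W" for y j
      using 0[OF that] Suc.IH[of y] supp[of x y] by auto
    then show ?case unfolding eta_Suc by (intro sum.neutral ballI) simp
  qed (simp add: N0)
  \<comment> \<open>The weighted energy; where the weight vanishes so does the vector, by \<open>zero\<close>.\<close>
  define q where "q p = (\<Sum>x\<in>W. \<Sum>i<m. (cmod (\<eta> p (x, i)))\<^sup>2 / N p x)" for p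
  have q_Suc: "q (Suc p) \<le> q p" for p
  proof -
    define u where "u x i y = (\<Sum>j<m. H (x, i) (y, j) * \<eta> p (y, j))" for x i y
    have le: "(cmod (\<eta> (Suc p) (x, i)))\<^sup>2 / N (Suc p) x \<le> (\<Sum>y\<in>W. (cmod (u x i y))\<^sup>2 / N p y)" for x i
    proof -
      have z: "u x i y = 0" if "of_bool (E x y) * N p y = 0" for y
        using that zero[of p y] supp[of x y] by (auto simp: u_def intro!: sum.neutral)
      have "(cmod (\<eta> (Suc p) (x, i)))\<^sup>2
          \<le> N (Suc p) x * (\<Sum>y\<in>W. (cmod (u x i y))\<^sup>2 / (of_bool (E x y) * N p y))"
        unfolding eta_Suc NS u_def[symmetric]
        by (rule weighted_cauchy_schwarz) (use Nnn z in auto)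
      also have "(\<Sum>y\<in>W. (cmod (u x i y))\<^sup>2 / (of_bool (E x y) * N p y))
          = (\<Sum>y\<in>W. (cmod (u x i y))\<^sup>2 / N p y)"
      proof (rule sum.cong[OF refl])
        fix y
        show "(cmod (u x i y))\<^sup>2 / (of_bool (E x y) * N p y) = (cmod (u x i y))\<^sup>2 / N p y"
          using z[of y] by (cases "E x y") auto
      qed
      finally have *: "(cmod (\<eta> (Suc p) (x, i)))\<^sup>2 \<le> N (Suc p) x * (\<Sum>y\<in>W. (cmod (u x i y))\<^sup>2 / N p y)" .
      have nn: "0 \<le> (\<Sum>y\<in>W. (cmod (u x i y))\<^sup>2 / N p y)"
        by (intro sum_nonneg divide_nonneg_nonneg) (auto simp: Nnn)
      show ?thesis
        using * nn Nnn[of "Suc p" x] by (cases "N (Suc p) x = 0") (auto simp: field_simps)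
    qed
    have "q (Suc p) \<le> (\<Sum>x\<in>W. \<Sum>i<m. \<Sum>y\<in>W. (cmod (u x i y))\<^sup>2 / N p y)"
      unfolding q_def by (intro sum_mono le)
    also have "\<dots> = (\<Sum>x\<in>W. \<Sum>y\<in>W. \<Sum>i<m. (cmod (u x i y))\<^sup>2 / N p y)"
      by (intro sum.cong refl sum.swap)
    also have "\<dots> = (\<Sum>y\<in>W. \<Sum>x\<in>W. \<Sum>i<m. (cmod (u x i y))\<^sup>2 / N p y)"
      by (rule sum.swap)
    also have "\<dots> = (\<Sum>y\<in>W. (\<Sum>x\<in>W. \<Sum>i<m. (cmod (u x i y))\<^sup>2) / N p y)"
      by (simp add: sum_divide_distrib)
    also have "\<dots> \<le> (\<Sum>y\<in>W. (\<Sum>j<m. (cmod (\<eta> p (y, j)))\<^sup>2) / N p y)"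
      unfolding u_def by (intro sum_mono divide_right_mono col) (auto simp: Nnn)
    also have "\<dots> = q p" by (simp add: q_def sum_divide_distrib)
    finally show ?thesis .
  qed
  have q_le: "q p \<le> q 0" for p
    by (induction p) (use q_Suc order.trans in blast)+
  have q_nonneg: "0 \<le> q p" for p
    unfolding q_def by (intro sum_nonneg divide_nonneg_nonneg) (auto simp: Nnn)
  have sq: "(\<Sum>x\<in>W. \<Sum>i<m. (cmod (\<eta> p (x, i)))\<^sup>2) \<le> C ^ p * sqrt (card W) * q 0" for p
  proof -
    have "(cmod (\<eta> p (x, i)))\<^sup>2 \<le> C ^ p * sqrt (card W) * ((cmod (\<eta> p (x, i)))\<^sup>2 / N p x)"
      if x: "x \<in> W" for x i
    proof (cases "N p x = 0")
      case False
      have "(cmod (\<eta> p (x, i)))\<^sup>2 = N p x * ((cmod (\<eta> p (x, i)))\<^sup>2 / N p x)"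
        using False by simp
      also have "\<dots> \<le> C ^ p * sqrt (card W) * ((cmod (\<eta> p (x, i)))\<^sup>2 / N p x)"
        by (intro mult_right_mono Nle x divide_nonneg_nonneg) (auto simp: Nnn)
      finally show ?thesis .
    qed (simp add: zero)
    then have "(\<Sum>x\<in>W. \<Sum>i<m. (cmod (\<eta> p (x, i)))\<^sup>2) \<le> C ^ p * sqrt (card W) * q p"
      unfolding q_def by (simp only: sum_distrib_left) (intro sum_mono, simp)
    also have "\<dots> \<le> C ^ p * sqrt (card W) * q 0"
      by (intro mult_left_mono q_le) (auto simp: C)
    finally show ?thesis .
  qed
  have prod: "(\<Sum>x\<in>W. \<Sum>i<m. g (x, i)) = sum g ?I" for g :: "_ \<Rightarrow> 'x::comm_monoid_add"
    by (simp add: sum.cartesian_product)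
  have "L2_set (\<lambda>i. cmod (mat_apply ?I H \<xi> i)) ?I \<le> sqrt C * L2_set (\<lambda>i. cmod (\<xi> i)) ?I"
  proof (rule hermitian_norm_le_growth[where D = "sqrt (sqrt (card W) * q 0)"])
    show "L2_set (\<lambda>i. cmod ((mat_apply ?I H ^^ p) \<xi> i)) ?I \<le> sqrt (sqrt (card W) * q 0) * sqrt C ^ p" for p
    proof -
      have "L2_set (\<lambda>i. cmod (\<eta> p i)) ?I \<le> sqrt (C ^ p * sqrt (card W) * q 0)"
        unfolding L2_set_def prod[symmetric] by (rule real_sqrt_le_mono[OF sq])
      also have "\<dots> = sqrt (sqrt (card W) * q 0) * sqrt C ^ p"
        by (simp only: mult.assoc real_sqrt_mult[of "C ^ p"] real_sqrt_power mult.commute[of "sqrt C ^ p"])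
      finally show ?thesis by (simp only: \<eta>_def)
    qed
    show "H j i = cnj (H i j)" for i j by (rule herm)
  qed (use W C in auto)
  then have "(L2_set (\<lambda>i. cmod (mat_apply ?I H \<xi> i)) ?I)\<^sup>2 \<le> (sqrt C * L2_set (\<lambda>i. cmod (\<xi> i)) ?I)\<^sup>2"
    by (rule power_mono) (rule L2_set_nonneg)
  then have "(\<Sum>p\<in>?I. (cmod (\<Sum>q\<in>?I. H p q * \<xi> q))\<^sup>2) \<le> C * (\<Sum>q\<in>?I. (cmod (\<xi> q))\<^sup>2)"
    using C by (simp add: power_mult_distrib L2_set_power2 mat_apply_def)
  then show ?thesis
    unfolding prod[of "\<lambda>q. H _ q * \<xi> q"] prod[of "\<lambda>q. (cmod (\<xi> q))\<^sup>2"]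
      prod[of "\<lambda>p. (cmod (\<Sum>q\<in>?I. H p q * \<xi> q))\<^sup>2"] .
qed

section \<open>Rows, columns and convolution operators\<close>

text \<open>
  The \<open>m \<times> m\<close> matrices \<open>a t\<close>, stacked into one column, act as a contraction; the next definition puts
  them side by side into one row.
\<close>
definition col_contr :: "'t set \<Rightarrow> nat \<Rightarrow> ('t \<Rightarrow> nat \<Rightarrow> nat \<Rightarrow> complex) \<Rightarrow> bool" where
  "col_contr T m a \<longleftrightarrow> (\<forall>v. (\<Sum>t\<in>T. \<Sum>i<m. (cmod (\<Sum>j<m. a t i j * v j))\<^sup>2)
     \<le> (\<Sum>j<m. (cmod (v j))\<^sup>2))"

definition row_contr :: "'t set \<Rightarrow> nat \<Rightarrow> ('t \<Rightarrow> nat \<Rightarrow> nat \<Rightarrow> complex) \<Rightarrow> bool" where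
  "row_contr T m a \<longleftrightarrow> (\<forall>w. (\<Sum>i<m. (cmod (\<Sum>t\<in>T. \<Sum>j<m. a t i j * w t j))\<^sup>2)
     \<le> (\<Sum>t\<in>T. \<Sum>j<m. (cmod (w t j))\<^sup>2))"

text \<open>
  The row is applied to the vectors \<open>w t\<close> that its own adjoint produces from \<open>v\<close>, and Cauchy--Schwarz
  bounds the pairing of the result with \<open>v\<close>.
\<close>
lemma row_contr_adjoint:
  assumes "row_contr T m a"
  shows "(\<Sum>t\<in>T. \<Sum>j<m. (cmod (\<Sum>i<m. cnj (a t i j) * v i))\<^sup>2) \<le> (\<Sum>i<m. (cmod (v i))\<^sup>2)"
proof -
  define w where "w t j = (\<Sum>i<m. cnj (a t i j) * v i)" for t j
  define u where "u i = (\<Sum>t\<in>T. \<Sum>j<m. a t i j * w t j)" for i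
  define q where "q = (\<Sum>t\<in>T. \<Sum>j<m. (cmod (w t j))\<^sup>2)"
  have q0: "0 \<le> q" by (simp add: q_def sum_nonneg)
  have u: "(L2_set (\<lambda>i. cmod (u i)) {..<m})\<^sup>2 \<le> q"
    using assms by (simp add: row_contr_def L2_set_power2 u_def q_def)
  have "complex_of_real q = (\<Sum>t\<in>T. \<Sum>j<m. w t j * cnj (w t j))"
    unfolding q_def of_real_sum complex_norm_square ..
  also have "\<dots> = (\<Sum>t\<in>T. \<Sum>j<m. \<Sum>i<m. cnj (v i) * (a t i j * w t j))"
    by (intro sum.cong refl, subst (2) w_def) (simp add: sum_distrib_left ac_simps)
  also have "\<dots> = (\<Sum>t\<in>T. \<Sum>i<m. \<Sum>j<m. cnj (v i) * (a t i j * w t j))"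
    by (intro sum.cong refl sum.swap)
  also have "\<dots> = (\<Sum>i<m. \<Sum>t\<in>T. \<Sum>j<m. cnj (v i) * (a t i j * w t j))"
    by (rule sum.swap)
  also have "\<dots> = (\<Sum>i<m. cnj (v i) * u i)"
    by (simp add: u_def sum_distrib_left)
  finally have "q = cmod (\<Sum>i<m. cnj (v i) * u i)"
    using q0 by (metis norm_of_real abs_of_nonneg)
  also have "\<dots> \<le> (\<Sum>i<m. cmod (v i) * cmod (u i))"
    by (rule order.trans[OF norm_sum]) (simp add: norm_mult)
  also have "\<dots> \<le> L2_set (\<lambda>i. cmod (v i)) {..<m} * L2_set (\<lambda>i. cmod (u i)) {..<m}"
    using L2_set_mult_ineq[of "\<lambda>i. cmod (v i)" "\<lambda>i. cmod (u i)" "{..<m}"] by simp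
  finally have "q\<^sup>2 \<le> (L2_set (\<lambda>i. cmod (v i)) {..<m} * L2_set (\<lambda>i. cmod (u i)) {..<m})\<^sup>2"
    using q0 by (intro power_mono) auto
  also have "\<dots> \<le> (L2_set (\<lambda>i. cmod (v i)) {..<m})\<^sup>2 * q"
    unfolding power_mult_distrib by (intro mult_left_mono u) simp
  finally have "q \<le> (L2_set (\<lambda>i. cmod (v i)) {..<m})\<^sup>2"
    using q0 by (cases "q = 0") (auto simp: power2_eq_square)
  then show ?thesis by (simp add: q_def w_def L2_set_power2)
qed

text \<open>
  For \<open>w \<ge> 0\<close> this says that convolution by \<open>w\<close>, with kernel \<open>(y, x) \<mapsto> w(y x\<^sup>-\<^sup>1)\<close>, has norm at most \<open>C\<close>
  on \<open>\<ell>\<^sup>2(G)\<close>. Testing only nonnegative vectors on finite sets makes the bound visibly monotone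
  in \<open>w\<close> and keeps all sums finite.
\<close>
definition kernel_bound :: "('g, 'b) monoid_scheme \<Rightarrow> ('g \<Rightarrow> real) \<Rightarrow> real \<Rightarrow> bool" where
  "kernel_bound G w C \<longleftrightarrow> (\<forall>A B f h. finite A \<longrightarrow> A \<subseteq> carrier G \<longrightarrow> finite B \<longrightarrow> B \<subseteq> carrier G \<longrightarrow>
     (\<forall>x. 0 \<le> f x) \<longrightarrow> (\<forall>x. 0 \<le> h x) \<longrightarrow>
     (\<Sum>x\<in>A. \<Sum>y\<in>B. w (y \<otimes>\<^bsub>G\<^esub> inv\<^bsub>G\<^esub> x) * f x * h y) \<le> C * L2_set f A * L2_set h B)"

lemma sum_filter_le:
  assumes "finite B" "finite F" "inj_on \<phi> B" "\<And>t. 0 \<le> (g t :: real)"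
  shows "(\<Sum>x\<in>B. if \<phi> x \<in> F then g (\<phi> x) else 0) \<le> sum g F"
proof -
  have "(\<Sum>x\<in>B. if \<phi> x \<in> F then g (\<phi> x) else 0) = (\<Sum>t\<in>\<phi> ` B. if t \<in> F then g t else 0)"
    by (simp add: sum.reindex[OF assms(3)])
  also have "\<dots> = (\<Sum>t\<in>\<phi> ` B \<inter> F. g t)"
    using assms(1) by (simp add: sum.inter_restrict)
  also have "\<dots> \<le> sum g F"
    using assms by (intro sum_mono2) auto
  finally show ?thesis .
qed

text \<open>
  The rectangular block matrix of \<open>\<Sum>\<^sub>t \<lambda>(t) \<otimes> a\<^sub>t\<close> with rows \<open>B\<close> and columns \<open>Z\<close> is made Hermitian as an
  off-diagonal block over the disjoint union of \<open>B\<close> and \<open>Z\<close>. An element \<open>t\<close> occurs at most once in each row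
  and each column of the group kernel, so contractivity of the block columns of the Hermitian matrix is
  contractivity of the column and of the row formed by \<open>a\<close>. This gives Haagerup's inequality
  \<open>\<parallel>\<Sum>\<^sub>t \<lambda>(t) \<otimes> a\<^sub>t\<parallel> \<le> \<parallel>\<Sum>\<^sub>t \<lambda>(t)\<parallel>\<^sup>1\<^sup>/\<^sup>2\<close>.
\<close>
lemma group_block_bound:
  fixes G :: "('g, 'b) monoid_scheme" (structure)
  assumes "group G" and F: "finite F" "F \<subseteq> carrier G"
    and C: "0 \<le> C" and kb: "kernel_bound G (\<lambda>t. of_bool (t \<in> F)) C"
    and col: "col_contr F m a" and row: "row_contr F m a"
    and B: "finite B" "B \<subseteq> carrier G"
    and Z: "Z = (\<lambda>(t, x). inv t \<otimes> x) ` (F \<times> B)"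
  shows "(\<Sum>x\<in>B. \<Sum>i<m. (cmod (\<Sum>t\<in>F. \<Sum>j<m. a t i j * \<xi> (inv t \<otimes> x) j))\<^sup>2)
    \<le> C * (\<Sum>z\<in>Z. \<Sum>j<m. (cmod (\<xi> z j))\<^sup>2)"
proof -
  interpret group G by fact
  have Zf: "finite Z" using F B by (simp add: Z)
  have Zc: "Z \<subseteq> carrier G" using F B by (auto simp: Z)
  define b where "b x z i j = (if x \<otimes> inv z \<in> F then a (x \<otimes> inv z) i j else 0)" for x z i j
  define H where "H = (\<lambda>(p, i) (q, j). case (p, q) of
      (Inl x, Inr z) \<Rightarrow> b x z i j | (Inr z, Inl x) \<Rightarrow> cnj (b x z j i) | _ \<Rightarrow> 0)"
  define E where "E = (\<lambda>p q. case (p, q) of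
      (Inl x, Inr z) \<Rightarrow> x \<otimes> inv z \<in> F | (Inr z, Inl x) \<Rightarrow> x \<otimes> inv z \<in> F | _ \<Rightarrow> False)"
  let ?W = "B <+> Z"
  have sumW: "(\<Sum>p\<in>?W. g p) = (\<Sum>x\<in>B. g (Inl x)) + (\<Sum>z\<in>Z. g (Inr z))" for g :: "_ \<Rightarrow> 'x::comm_monoid_add"
    using B(1) Zf by (simp add: sum.Plus)
  have inj: "inj_on (\<lambda>x. x \<otimes> inv z) B" if "z \<in> carrier G" for z
    using B(2) that by (intro inj_onI) (metis inv_closed right_cancel subsetD)
  have inj': "inj_on (\<lambda>z. x \<otimes> inv z) Z" if "x \<in> carrier G" for x
    using Zc that by (intro inj_onI) (metis inv_closed inv_inv Units_l_cancel Units_eq subsetD)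
  have adj: "(\<Sum>p\<in>?W. \<Sum>q\<in>?W. of_bool (E p q) * f p * h q) \<le> C * L2_set f ?W * L2_set h ?W"
    if nn: "\<And>x. 0 \<le> f x" "\<And>x. 0 \<le> h x" for f h
  proof -
    let ?a = "L2_set (\<lambda>x. f (Inl x)) B" and ?b = "L2_set (\<lambda>x. f (Inr x)) Z"
    let ?c = "L2_set (\<lambda>x. h (Inl x)) B" and ?d = "L2_set (\<lambda>x. h (Inr x)) Z"
    have "(\<Sum>p\<in>?W. \<Sum>q\<in>?W. of_bool (E p q) * f p * h q)
      = (\<Sum>x\<in>B. \<Sum>z\<in>Z. of_bool (x \<otimes> inv z \<in> F) * f (Inl x) * h (Inr z))
        + (\<Sum>z\<in>Z. \<Sum>x\<in>B. of_bool (x \<otimes> inv z \<in> F) * f (Inr z) * h (Inl x))"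
      by (simp add: sumW E_def)
    also have "(\<Sum>x\<in>B. \<Sum>z\<in>Z. of_bool (x \<otimes> inv z \<in> F) * f (Inl x) * h (Inr z))
        = (\<Sum>z\<in>Z. \<Sum>x\<in>B. of_bool (x \<otimes> inv z \<in> F) * h (Inr z) * f (Inl x))"
      by (subst sum.swap) (simp add: ac_simps)
    also have "\<dots> \<le> C * ?d * ?a"
      using kb[unfolded kernel_bound_def, rule_format, OF Zf Zc B, of "\<lambda>z. h (Inr z)" "\<lambda>z. f (Inl z)"] nn
      by simp
    also have "(\<Sum>z\<in>Z. \<Sum>x\<in>B. of_bool (x \<otimes> inv z \<in> F) * f (Inr z) * h (Inl x)) \<le> C * ?b * ?c"
      using kb[unfolded kernel_bound_def, rule_format, OF Zf Zc B, of "\<lambda>z. f (Inr z)" "\<lambda>z. h (Inl z)"] nn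
      by simp
    finally have "(\<Sum>p\<in>?W. \<Sum>q\<in>?W. of_bool (E p q) * f p * h q) \<le> C * (?a * ?d + ?b * ?c)"
      by (simp add: algebra_simps)
    also have "\<dots> \<le> C * (L2_set f ?W * L2_set h ?W)"
    proof (rule mult_left_mono[OF _ C])
      have L2W: "L2_set g ?W = sqrt ((L2_set (\<lambda>x. g (Inl x)) B)\<^sup>2 + (L2_set (\<lambda>x. g (Inr x)) Z)\<^sup>2)"
        for g :: "_ \<Rightarrow> real"
        by (subst L2_set_def) (simp only: sumW L2_set_power2)
      have "0 \<le> (?a * ?c - ?b * ?d)\<^sup>2" by simp
      then have "(?a * ?d + ?b * ?c)\<^sup>2 \<le> (?a\<^sup>2 + ?b\<^sup>2) * (?c\<^sup>2 + ?d\<^sup>2)"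
        by (simp add: power2_eq_square algebra_simps)
      then show "?a * ?d + ?b * ?c \<le> L2_set f ?W * L2_set h ?W"
        unfolding L2W real_sqrt_mult[symmetric] by (rule real_le_rsqrt)
    qed
    finally show ?thesis by (simp add: ac_simps)
  qed
  have col': "(\<Sum>p\<in>?W. \<Sum>i<m. (cmod (\<Sum>j<m. H (p, i) (q, j) * v j))\<^sup>2) \<le> (\<Sum>j<m. (cmod (v j))\<^sup>2)"
    if q: "q \<in> ?W" for q v
  proof (cases q)
    case (Inr z)
    then have z: "z \<in> carrier G" using q Zc by auto
    let ?g = "\<lambda>t. \<Sum>i<m. (cmod (\<Sum>j<m. a t i j * v j))\<^sup>2"
    have "(\<Sum>p\<in>?W. \<Sum>i<m. (cmod (\<Sum>j<m. H (p, i) (q, j) * v j))\<^sup>2)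
      = (\<Sum>x\<in>B. if x \<otimes> inv z \<in> F then ?g (x \<otimes> inv z) else 0)"
      unfolding sumW by (simp add: H_def Inr b_def cong: if_cong) (intro sum.cong refl, simp)
    also have "\<dots> \<le> sum ?g F"
      by (rule sum_filter_le[OF B(1) F(1) inj[OF z]]) (simp add: sum_nonneg)
    also have "\<dots> \<le> (\<Sum>j<m. (cmod (v j))\<^sup>2)"
      using col by (simp add: col_contr_def)
    finally show ?thesis .
  next
    case (Inl x)
    then have x: "x \<in> carrier G" using q B by auto
    let ?g = "\<lambda>t. \<Sum>i<m. (cmod (\<Sum>j<m. cnj (a t j i) * v j))\<^sup>2"
    have "(\<Sum>p\<in>?W. \<Sum>i<m. (cmod (\<Sum>j<m. H (p, i) (q, j) * v j))\<^sup>2)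
      = (\<Sum>z\<in>Z. if x \<otimes> inv z \<in> F then ?g (x \<otimes> inv z) else 0)"
      unfolding sumW by (simp add: H_def Inl b_def cong: if_cong) (intro sum.cong refl, simp)
    also have "\<dots> \<le> sum ?g F"
      by (rule sum_filter_le[OF Zf F(1) inj'[OF x]]) (simp add: sum_nonneg)
    also have "\<dots> \<le> (\<Sum>j<m. (cmod (v j))\<^sup>2)"
      by (rule row_contr_adjoint[OF row])
    finally show ?thesis .
  qed
  define \<zeta> :: "('g + 'g) \<times> nat \<Rightarrow> complex" where "\<zeta> = (\<lambda>(p, j). case p of Inl x \<Rightarrow> 0 | Inr z \<Rightarrow> \<xi> z j)"
  have main: "(\<Sum>p\<in>?W. \<Sum>i<m. (cmod (\<Sum>q\<in>?W. \<Sum>j<m. H (p, i) (q, j) * \<zeta> (q, j)))\<^sup>2)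
    \<le> C * (\<Sum>q\<in>?W. \<Sum>j<m. (cmod (\<zeta> (q, j)))\<^sup>2)"
    by (rule hermitian_block_bound[where E = E])
      (use B(1) Zf C adj col' in \<open>auto simp: H_def E_def b_def split: sum.splits\<close>)
  have conv: "(\<Sum>z\<in>Z. \<Sum>j<m. b x z i j * \<xi> z j) = (\<Sum>t\<in>F. \<Sum>j<m. a t i j * \<xi> (inv t \<otimes> x) j)"
    if x: "x \<in> B" for x i
  proof -
    have xc: "x \<in> carrier G" using x B by auto
    have "(\<Sum>z\<in>Z. \<Sum>j<m. b x z i j * \<xi> z j) = (\<Sum>z\<in>{z\<in>Z. x \<otimes> inv z \<in> F}. \<Sum>j<m. b x z i j * \<xi> z j)"
      by (rule sum.mono_neutral_right) (use Zf in \<open>auto simp: b_def\<close>)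
    also have "\<dots> = (\<Sum>t\<in>F. \<Sum>j<m. a t i j * \<xi> (inv t \<otimes> x) j)"
    proof (rule sum.reindex_bij_witness[where i = "\<lambda>t. inv t \<otimes> x" and j = "\<lambda>z. x \<otimes> inv z"])
      fix z assume z: "z \<in> {z\<in>Z. x \<otimes> inv z \<in> F}"
      then have zc: "z \<in> carrier G" using Zc by auto
      show eq: "inv (x \<otimes> inv z) \<otimes> x = z"
        using zc xc by (simp add: inv_mult_group m_assoc)
      show "x \<otimes> inv z \<in> F" using z by simp
      show "(\<Sum>j<m. a (x \<otimes> inv z) i j * \<xi> (inv (x \<otimes> inv z) \<otimes> x) j) = (\<Sum>j<m. b x z i j * \<xi> z j)"
        unfolding eq using z by (simp add: b_def)
    next
      fix t assume t: "t \<in> F"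
      then have tc: "t \<in> carrier G" using F by auto
      show eq: "x \<otimes> inv (inv t \<otimes> x) = t"
        using tc xc by (simp add: inv_mult_group m_assoc[symmetric])
      have "inv t \<otimes> x \<in> Z" using t x by (auto simp: Z)
      then show "inv t \<otimes> x \<in> {z\<in>Z. x \<otimes> inv z \<in> F}" using eq t by simp
    qed
    finally show ?thesis .
  qed
  have "(\<Sum>x\<in>B. \<Sum>i<m. (cmod (\<Sum>t\<in>F. \<Sum>j<m. a t i j * \<xi> (inv t \<otimes> x) j))\<^sup>2)
      = (\<Sum>x\<in>B. \<Sum>i<m. (cmod (\<Sum>z\<in>Z. \<Sum>j<m. b x z i j * \<xi> z j))\<^sup>2)"
    by (simp add: conv)
  also have "\<dots> = (\<Sum>x\<in>B. \<Sum>i<m. (cmod (\<Sum>q\<in>?W. \<Sum>j<m. H (Inl x, i) (q, j) * \<zeta> (q, j)))\<^sup>2)"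
    unfolding sumW by (simp add: H_def \<zeta>_def)
  also have "\<dots> \<le> (\<Sum>p\<in>?W. \<Sum>i<m. (cmod (\<Sum>q\<in>?W. \<Sum>j<m. H (p, i) (q, j) * \<zeta> (q, j)))\<^sup>2)"
    by (subst (2) sumW) (simp add: sum_nonneg)
  also note main
  also have "(\<Sum>q\<in>?W. \<Sum>j<m. (cmod (\<zeta> (q, j)))\<^sup>2) = (\<Sum>z\<in>Z. \<Sum>j<m. (cmod (\<xi> z j))\<^sup>2)"
    unfolding sumW by (simp add: \<zeta>_def)
  finally show ?thesis .
qed

section \<open>Bounded operators and operator matrices\<close>

lemma ell2_finite_support:
  assumes "finite A" "A \<subseteq> X" "\<And>x. x \<notin> A \<Longrightarrow> \<xi> x = 0"
  shows "\<xi> \<in> ell2 X" and "ell2_norm \<xi> = L2_set (\<lambda>x. cmod (\<xi> x)) A"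
proof -
  have "(\<lambda>x. (cmod (\<xi> x))\<^sup>2) summable_on UNIV \<longleftrightarrow> (\<lambda>x. (cmod (\<xi> x))\<^sup>2) summable_on A"
    by (rule summable_on_cong_neutral) (use assms(3) in auto)
  then show "\<xi> \<in> ell2 X" using assms by (auto simp: ell2_def)
  have "(\<Sum>\<^sub>\<infinity>x. (cmod (\<xi> x))\<^sup>2) = (\<Sum>\<^sub>\<infinity>x\<in>A. (cmod (\<xi> x))\<^sup>2)"
    by (rule infsum_cong_neutral) (use assms(3) in auto)
  then show "ell2_norm \<xi> = L2_set (\<lambda>x. cmod (\<xi> x)) A"
    using assms(1) by (simp add: ell2_norm_def L2_set_def)
qed

lemma ell2_norm_nonneg: "0 \<le> ell2_norm \<xi>"
  by (simp add: ell2_norm_def infsum_nonneg)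

lemma sum_le_ell2_norm:
  assumes "\<xi> \<in> ell2 X" "finite B"
  shows "(\<Sum>x\<in>B. (cmod (\<xi> x))\<^sup>2) \<le> (ell2_norm \<xi>)\<^sup>2"
proof -
  have "(\<Sum>x\<in>B. (cmod (\<xi> x))\<^sup>2) \<le> (\<Sum>\<^sub>\<infinity>x. (cmod (\<xi> x))\<^sup>2)"
    using assms by (intro finite_sum_le_infsum) (auto simp: ell2_def)
  then show ?thesis by (simp add: ell2_norm_def infsum_nonneg)
qed

lemma ell2_norm_le:
  assumes "\<And>B. finite B \<Longrightarrow> (\<Sum>x\<in>B. (cmod (\<xi> x))\<^sup>2) \<le> c\<^sup>2" "0 \<le> c"
  shows "ell2_norm \<xi> \<le> c"
proof -
  have "(\<Sum>\<^sub>\<infinity>x. (cmod (\<xi> x))\<^sup>2) \<le> c\<^sup>2"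
  proof (cases "(\<lambda>x. (cmod (\<xi> x))\<^sup>2) summable_on UNIV")
    case True
    then show ?thesis by (rule infsum_le_finite_sums) (use assms in auto)
  qed (simp add: infsum_not_exists)
  then show ?thesis unfolding ell2_norm_def by (intro real_le_lsqrt assms(2))
qed

lemma ell2I:
  assumes "\<And>x. x \<notin> X \<Longrightarrow> \<xi> x = 0"
    and "\<And>B. finite B \<Longrightarrow> (\<Sum>x\<in>B. (cmod (\<xi> x))\<^sup>2) \<le> c"
  shows "\<xi> \<in> ell2 X"
proof -
  have "(\<lambda>x. (cmod (\<xi> x))\<^sup>2) summable_on UNIV"
    by (rule nonneg_bdd_above_summable_on) (use assms(2) in \<open>auto intro!: bdd_aboveI[of _ c]\<close>)
  then show ?thesis using assms(1) by (simp add: ell2_def)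
qed

lemma ell2_zero: "(\<lambda>x. 0) \<in> ell2 X"
  by (simp add: ell2_def)

lemma ell2_sum:
  assumes "\<And>t. t \<in> F \<Longrightarrow> e t \<in> ell2 X"
  shows "(\<lambda>x. \<Sum>t\<in>F. c t * e t x) \<in> ell2 X"
  using assms
proof (induction F rule: infinite_finite_induct)
  case (insert s F)
  then show ?case using ell2_lincomb[of "e s" X "\<lambda>x. \<Sum>t\<in>F. c t * e t x" "c s" 1] by simp
qed (simp_all add: ell2_zero)

lemma bounded_ops_lincomb:
  assumes "T \<in> bounded_ops X" "\<xi> \<in> ell2 X" "\<eta> \<in> ell2 X"
  shows "T (\<lambda>x. a * \<xi> x + b * \<eta> x) = (\<lambda>x. a * T \<xi> x + b * T \<eta> x)"
  using assms by (auto simp: bounded_ops_def)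

lemma bounded_ops_ell2: "T \<in> bounded_ops X \<Longrightarrow> \<xi> \<in> ell2 X \<Longrightarrow> T \<xi> \<in> ell2 X"
  by (auto simp: bounded_ops_def)

lemma bounded_ops_scale:
  assumes "T \<in> bounded_ops X" "\<xi> \<in> ell2 X"
  shows "T (\<lambda>x. a * \<xi> x) = (\<lambda>x. a * T \<xi> x)"
  using bounded_ops_lincomb[OF assms assms(2), of a 0] by simp

lemma bounded_ops_zero: "T \<in> bounded_ops X \<Longrightarrow> T (\<lambda>x. 0) = (\<lambda>x. 0)"
  using bounded_ops_scale[OF _ ell2_zero, of T X 0] by simp

lemma bounded_ops_sum:
  assumes T: "T \<in> bounded_ops X" and e: "\<And>t. t \<in> F \<Longrightarrow> e t \<in> ell2 X"
  shows "T (\<lambda>x. \<Sum>t\<in>F. c t * e t x) = (\<lambda>x. \<Sum>t\<in>F. c t * T (e t) x)"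
  using e
proof (induction F rule: infinite_finite_induct)
  case (insert s F)
  then show ?case
    using bounded_ops_lincomb[OF T, of "e s" "\<lambda>x. \<Sum>t\<in>F. c t * e t x" "c s" 1]
    by (simp add: ell2_sum)
qed (simp_all add: bounded_ops_zero[OF T])

lemma ell2_slice:
  assumes "\<xi> \<in> ell2 (X \<times> Y)"
  shows "(\<lambda>b. \<xi> (b, j)) \<in> ell2 X"
proof (rule ell2I)
  show "\<xi> (b, j) = 0" if "b \<notin> X" for b using assms that by (auto simp: ell2_def)
  show "(\<Sum>b\<in>B. (cmod (\<xi> (b, j)))\<^sup>2) \<le> (ell2_norm \<xi>)\<^sup>2" if "finite B" for B
  proof -
    have "(\<Sum>b\<in>B. (cmod (\<xi> (b, j)))\<^sup>2) = (\<Sum>p\<in>(\<lambda>b. (b, j)) ` B. (cmod (\<xi> p))\<^sup>2)"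
      by (subst sum.reindex) (auto simp: inj_on_def)
    also have "\<dots> \<le> (ell2_norm \<xi>)\<^sup>2"
      by (rule sum_le_ell2_norm[OF assms]) (use that in simp)
    finally show ?thesis .
  qed
qed

lemma sum_le_sum_rectangle:
  fixes f :: "'x \<times> nat \<Rightarrow> real"
  assumes "finite B" "\<And>p. 0 \<le> f p" "\<And>a i. m \<le> i \<Longrightarrow> f (a, i) = 0"
  shows "sum f B \<le> (\<Sum>a\<in>fst ` B. \<Sum>i<m. f (a, i))"
proof -
  have "sum f B \<le> sum f (B \<union> fst ` B \<times> {..<m})"
    using assms by (intro sum_mono2) auto
  also have "\<dots> = sum f (fst ` B \<times> {..<m})"
  proof (rule sum.mono_neutral_right)
    show "\<forall>p\<in>B \<union> fst ` B \<times> {..<m} - fst ` B \<times> {..<m}. f p = 0"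
      using assms(3) by (auto simp: not_less image_iff Bex_def) (metis fst_conv not_less)
  qed (use assms in auto)
  also have "\<dots> = (\<Sum>a\<in>fst ` B. \<Sum>i<m. f (a, i))"
    by (simp add: sum.cartesian_product)
  finally show ?thesis .
qed

lemma mat_op_ell2:
  assumes x: "\<And>i j. i < m \<Longrightarrow> j < m \<Longrightarrow> x i j \<in> bounded_ops X"
    and \<xi>: "\<xi> \<in> ell2 (X \<times> {..<m})"
  shows "mat_op m x \<xi> \<in> ell2 (X \<times> {..<m})"
proof (rule ell2I)
  have row: "(\<lambda>a. mat_op m x \<xi> (a, i)) \<in> ell2 X" for i
  proof (cases "i < m")
    case True
    have "(\<lambda>a. \<Sum>j<m. 1 * x i j (\<lambda>b. \<xi> (b, j)) a) \<in> ell2 X"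
      by (rule ell2_sum) (use bounded_ops_ell2[OF x ell2_slice[OF \<xi>]] True in auto)
    then show ?thesis using True by (simp add: mat_op_def)
  qed (simp add: mat_op_def ell2_zero)
  show "mat_op m x \<xi> p = 0" if "p \<notin> X \<times> {..<m}" for p
    using that row[of "snd p"] by (cases p) (auto simp: ell2_def mat_op_def)
  fix B :: "('a \<times> nat) set"
  assume B: "finite B"
  have "(\<Sum>p\<in>B. (cmod (mat_op m x \<xi> p))\<^sup>2) \<le> (\<Sum>a\<in>fst ` B. \<Sum>i<m. (cmod (mat_op m x \<xi> (a, i)))\<^sup>2)"
    by (rule sum_le_sum_rectangle[OF B]) (auto simp: mat_op_def)
  also have "\<dots> = (\<Sum>i<m. \<Sum>a\<in>fst ` B. (cmod (mat_op m x \<xi> (a, i)))\<^sup>2)"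
    by (rule sum.swap)
  also have "\<dots> \<le> (\<Sum>i<m. (ell2_norm (\<lambda>a. mat_op m x \<xi> (a, i)))\<^sup>2)"
    by (intro sum_mono sum_le_ell2_norm[OF row]) (use B in auto)
  finally show "(\<Sum>p\<in>B. (cmod (mat_op m x \<xi> p))\<^sup>2) \<le> (\<Sum>i<m. (ell2_norm (\<lambda>a. mat_op m x \<xi> (a, i)))\<^sup>2)" .
qed

text \<open>
  The form in which \<open>mat_norm X m x \<le> 1\<close> is used: on a finitely supported vector, which is scaled to norm 1,
  and on finitely many entries of its image.
\<close>
lemma mat_op_contraction:
  assumes x: "\<And>i j. i < m \<Longrightarrow> j < m \<Longrightarrow> x i j \<in> bounded_ops X"
    and norm: "mat_norm X m x \<le> 1"
    and A: "finite A" "A \<subseteq> X \<times> {..<m}" "\<And>p. p \<notin> A \<Longrightarrow> \<xi> p = 0"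
    and B: "finite B"
  shows "(\<Sum>p\<in>B. (cmod (mat_op m x \<xi> p))\<^sup>2) \<le> (\<Sum>p\<in>A. (cmod (\<xi> p))\<^sup>2)"
proof -
  note \<xi> = ell2_finite_support[where \<xi> = \<xi>, OF A]
  define r where "r = ell2_norm \<xi>"
  have r2: "r\<^sup>2 = (\<Sum>p\<in>A. (cmod (\<xi> p))\<^sup>2)"
    by (simp add: r_def \<xi>(2) L2_set_power2)
  have r0: "0 \<le> r" by (simp add: r_def ell2_norm_nonneg)
  show ?thesis
  proof (cases "r = 0")
    case True
    then have "\<xi> p = 0" for p
      using r2 A by (cases "p \<in> A") (auto simp: sum_nonneg_eq_0_iff)
    then have "mat_op m x \<xi> p = 0" for p
      using bounded_ops_zero[OF x] by (cases p) (auto simp: mat_op_def)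
    then show ?thesis by (simp add: sum_nonneg)
  next
    case False
    with r0 have r: "0 < r" by simp
    define \<zeta> where "\<zeta> = (\<lambda>p. complex_of_real (1 / r) * \<xi> p)"
    have \<zeta>A: "\<And>p. p \<notin> A \<Longrightarrow> \<zeta> p = 0" by (simp add: \<zeta>_def A)
    note \<zeta> = ell2_finite_support[where \<xi> = \<zeta>, OF A(1,2) \<zeta>A]
    have "ell2_norm \<zeta> = L2_set (\<lambda>p. cmod (\<zeta> p)) A"
      by (rule \<zeta>(2))
    also have "\<dots> = L2_set (\<lambda>p. (1 / r) * cmod (\<xi> p)) A"
      using r by (simp add: \<zeta>_def norm_mult norm_divide)
    also have "\<dots> = (1 / r) * r"
      using L2_set_right_distrib[of "1 / r" "\<lambda>p. cmod (\<xi> p)" A] r \<xi>(2) by (simp add: r_def)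
    finally have "ell2_norm \<zeta> \<le> 1" using r by simp
    then have "ennreal (ell2_norm (mat_op m x \<zeta>)) \<le> mat_norm X m x"
      unfolding mat_norm_def op_norm_def using \<zeta>(1) by (intro SUP_upper) simp
    with norm have "ennreal (ell2_norm (mat_op m x \<zeta>)) \<le> 1" by (rule order.trans[rotated])
    then have le: "ell2_norm (mat_op m x \<zeta>) \<le> 1" by simp
    have eq: "mat_op m x \<xi> p = r * mat_op m x \<zeta> p" for p
    proof (cases p)
      case (Pair a i)
      have "x i j (\<lambda>b. \<zeta> (b, j)) a = (1 / r) * x i j (\<lambda>b. \<xi> (b, j)) a" if "i < m" "j < m" for j
        using bounded_ops_scale[OF x[OF that] ell2_slice[OF \<xi>(1)], where a = "complex_of_real (1/r)"]
        by (simp only: \<zeta>_def) simp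
      then show ?thesis using r by (simp add: Pair mat_op_def sum_distrib_left)
    qed
    have "(\<Sum>p\<in>B. (cmod (mat_op m x \<xi> p))\<^sup>2) = r\<^sup>2 * (\<Sum>p\<in>B. (cmod (mat_op m x \<zeta> p))\<^sup>2)"
      by (simp add: eq norm_mult power_mult_distrib sum_distrib_left)
    also have "\<dots> \<le> r\<^sup>2 * (ell2_norm (mat_op m x \<zeta>))\<^sup>2"
      by (intro mult_left_mono sum_le_ell2_norm[OF mat_op_ell2[OF x \<zeta>(1)] B]) auto
    also have "\<dots> \<le> r\<^sup>2 * 1"
      by (intro mult_left_mono power_le_one) (auto simp: le ell2_norm_nonneg)
    finally show ?thesis using r2 by simp
  qed
qed

text \<open>
  The constants \<open>K\<close> are the operator norms, so the sum is bounded by the triangle inequality, applied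
  to the restrictions to a finite set.
\<close>
lemma bounded_ops_sum_closed:
  fixes X :: "'x set"
  assumes T: "\<And>t. t \<in> F \<Longrightarrow> T t \<in> bounded_ops X"
  shows "(\<lambda>\<xi> x. \<Sum>t\<in>F. c t * T t \<xi> x) \<in> bounded_ops X"
proof -
  let ?S = "\<lambda>\<xi> x. \<Sum>t\<in>F. c t * T t \<xi> x"
  define K where "K t = enn2real (op_norm X (T t))" for t
  have K: "ell2_norm (T t \<xi>) \<le> K t" if "t \<in> F" "\<xi> \<in> ell2 X" "ell2_norm \<xi> \<le> 1" for t \<xi>
  proof -
    have "ennreal (ell2_norm (T t \<xi>)) \<le> op_norm X (T t)"
      unfolding op_norm_def using that by (intro SUP_upper) simp
    also have "\<dots> = ennreal (K t)"
      using T[OF that(1)] by (simp add: K_def bounded_ops_def)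
    finally show ?thesis by (simp add: K_def)
  qed
  have "op_norm X ?S \<le> ennreal (\<Sum>t\<in>F. cmod (c t) * K t)"
    unfolding op_norm_def
  proof (rule SUP_least, rule ennreal_leI, rule ell2_norm_le)
    fix \<xi> and B :: "'x set"
    assume \<xi>: "\<xi> \<in> {\<xi> \<in> ell2 X. ell2_norm \<xi> \<le> 1}" and B: "finite B"
    have "L2_set (\<lambda>x. cmod (?S \<xi> x)) B \<le> L2_set (\<lambda>x. \<Sum>t\<in>F. cmod (c t * T t \<xi> x)) B"
      by (rule L2_set_mono) (auto intro: norm_sum)
    also have "\<dots> \<le> (\<Sum>t\<in>F. L2_set (\<lambda>x. cmod (c t * T t \<xi> x)) B)"
      by (rule L2_set_sum_le)
    also have "\<dots> \<le> (\<Sum>t\<in>F. cmod (c t) * K t)"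
    proof (rule sum_mono)
      fix t assume t: "t \<in> F"
      have "L2_set (\<lambda>x. cmod (c t * T t \<xi> x)) B = cmod (c t) * L2_set (\<lambda>x. cmod (T t \<xi> x)) B"
        by (simp add: norm_mult L2_set_right_distrib)
      also have "L2_set (\<lambda>x. cmod (T t \<xi> x)) B \<le> ell2_norm (T t \<xi>)"
        using sum_le_ell2_norm[OF bounded_ops_ell2[OF T[OF t]] B, of \<xi>] \<xi>
        unfolding L2_set_def by (simp add: real_le_lsqrt ell2_norm_nonneg sum_nonneg)
      also have "\<dots> \<le> K t" using K t \<xi> by simp
      finally show "L2_set (\<lambda>x. cmod (c t * T t \<xi> x)) B \<le> cmod (c t) * K t"
        by (simp add: mult_left_mono)
    qed
    finally have "(L2_set (\<lambda>x. cmod (?S \<xi> x)) B)\<^sup>2 \<le> (\<Sum>t\<in>F. cmod (c t) * K t)\<^sup>2"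
      by (rule power_mono) simp
    then show "(\<Sum>x\<in>B. (cmod (?S \<xi> x))\<^sup>2) \<le> (\<Sum>t\<in>F. cmod (c t) * K t)\<^sup>2"
      by (simp add: L2_set_power2)
  qed (simp add: sum_nonneg K_def)
  then have "op_norm X ?S < \<infinity>" by (rule le_less_trans) simp
  moreover have "?S \<xi> \<in> ell2 X" if "\<xi> \<in> ell2 X" for \<xi>
    using that by (intro ell2_sum bounded_ops_ell2[OF T])
  moreover have "?S (\<lambda>x. a * \<xi> x + b * \<eta> x) = (\<lambda>x. a * ?S \<xi> x + b * ?S \<eta> x)"
    if "\<xi> \<in> ell2 X" "\<eta> \<in> ell2 X" for \<xi> \<eta> a b
    using bounded_ops_lincomb[OF T that]
    by (simp add: sum_distrib_left sum.distrib distrib_left mult.left_commute)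
  moreover have "?S \<xi> = (\<lambda>_. 0)" if "\<xi> \<notin> ell2 X" for \<xi>
    using T that by (simp add: bounded_ops_def)
  ultimately show ?thesis by (simp add: bounded_ops_def)
qed

section \<open>Fourier coefficients in the group von Neumann algebra\<close>

definition right_regular :: "('g, 'b) monoid_scheme \<Rightarrow> 'g \<Rightarrow> 'g op" where
  "right_regular G g \<xi> =
     (if \<xi> \<in> ell2 (carrier G)
      then (\<lambda>x. if x \<in> carrier G then \<xi> (x \<otimes>\<^bsub>G\<^esub> g) else 0)
      else (\<lambda>_. 0))"

lemma right_regular_in_commutant:
  fixes G (structure)
  assumes "group G" and g: "g \<in> carrier G"
  shows "right_regular G g \<in> commutant (carrier G) (left_regular G ` carrier G)"
proof -
  interpret group G by fact
  have bound: "(\<Sum>x\<in>B. (cmod (right_regular G g \<xi> x))\<^sup>2) \<le> (ell2_norm \<xi>)\<^sup>2"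
    if \<xi>: "\<xi> \<in> ell2 (carrier G)" and B: "finite B" for \<xi> B
  proof -
    have "(\<Sum>x\<in>B. (cmod (right_regular G g \<xi> x))\<^sup>2) = (\<Sum>x\<in>B \<inter> carrier G. (cmod (\<xi> (x \<otimes> g)))\<^sup>2)"
      by (rule sum.mono_neutral_cong_right) (use B \<xi> in \<open>auto simp: right_regular_def\<close>)
    also have "\<dots> = (\<Sum>y\<in>(\<lambda>x. x \<otimes> g) ` (B \<inter> carrier G). (cmod (\<xi> y))\<^sup>2)"
      by (subst sum.reindex) (use g in \<open>auto simp: inj_on_def\<close>)
    also have "\<dots> \<le> (ell2_norm \<xi>)\<^sup>2"
      by (rule sum_le_ell2_norm[OF \<xi>]) (use B in simp)
    finally show ?thesis .
  qed
  have cl: "right_regular G g \<xi> \<in> ell2 (carrier G)" if "\<xi> \<in> ell2 (carrier G)" for \<xi>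
    by (rule ell2I[OF _ bound[OF that]]) (auto simp: right_regular_def)
  have "op_norm (carrier G) (right_regular G g) \<le> 1"
    unfolding op_norm_def
  proof (rule SUP_least)
    fix \<xi> assume \<xi>: "\<xi> \<in> {\<xi> \<in> ell2 (carrier G). ell2_norm \<xi> \<le> 1}"
    then have "ell2_norm (right_regular G g \<xi>) \<le> ell2_norm \<xi>"
      by (intro ell2_norm_le bound) (auto simp: ell2_norm_nonneg)
    then show "ennreal (ell2_norm (right_regular G g \<xi>)) \<le> 1" using \<xi> by simp
  qed
  then have "op_norm (carrier G) (right_regular G g) < \<infinity>" by (rule le_less_trans) simp
  then have "right_regular G g \<in> bounded_ops (carrier G)"
    using cl ell2_lincomb[of _ "carrier G"] unfolding bounded_ops_def
    by (auto simp: right_regular_def)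
  moreover have "right_regular G g \<circ> left_regular G s = left_regular G s \<circ> right_regular G g"
    if s: "s \<in> carrier G" for s
  proof
    fix \<xi>
    have cl': "left_regular G s \<xi> \<in> ell2 (carrier G)"
    proof (cases "\<xi> \<in> ell2 (carrier G)")
      case True
      then show ?thesis
        by (rule bounded_ops_ell2[OF left_regular_in_bounded_ops[OF \<open>group G\<close> s]])
    qed (simp add: left_regular_def ell2_zero)
    show "(right_regular G g \<circ> left_regular G s) \<xi> = (left_regular G s \<circ> right_regular G g) \<xi>"
      using cl[of \<xi>] cl' g s ell2_zero[of "carrier G"]
      by (auto simp: right_regular_def left_regular_def m_assoc fun_eq_iff)
  qed
  ultimately show ?thesis by (auto simp: commutant_def)
qed

definition delta :: "'x \<Rightarrow> 'x \<Rightarrow> complex" where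
  "delta s = (\<lambda>x. of_bool (x = s))"

lemma delta_ell2: "s \<in> X \<Longrightarrow> delta s \<in> ell2 X"
  by (rule ell2_finite_support(1)[of "{s}"]) (auto simp: delta_def)

definition fourier_coeff :: "('g, 'b) monoid_scheme \<Rightarrow> 'g op \<Rightarrow> 'g \<Rightarrow> complex" where
  "fourier_coeff G T t = T (delta \<one>\<^bsub>G\<^esub>) t"

lemma group_vN_algebra_bounded: "T \<in> group_vN_algebra G \<Longrightarrow> T \<in> bounded_ops (carrier G)"
  by (simp add: group_vN_algebra_def commutant_def)

text \<open>
  An element of the von Neumann algebra commutes with right translations, so one column of its
  matrix determines all others.
\<close>
lemma group_vN_algebra_delta_inv:
  fixes G (structure)
  assumes "group G" and T: "T \<in> group_vN_algebra G" and t: "t \<in> carrier G"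
  shows "T (delta (inv t)) \<one> = fourier_coeff G T t"
proof -
  interpret group G by fact
  have "right_regular G t (delta \<one>) = delta (inv t)"
  proof
    fix x
    have "x \<otimes> t = \<one> \<longleftrightarrow> x = inv t" if "x \<in> carrier G"
      using that t inv_equality by fastforce
    then show "right_regular G t (delta \<one>) x = delta (inv t) x"
      using delta_ell2[of "\<one>" "carrier G"] t by (auto simp: right_regular_def delta_def)
  qed
  then have "T (delta (inv t)) = (T \<circ> right_regular G t) (delta \<one>)" by simp
  also have "\<dots> = (right_regular G t \<circ> T) (delta \<one>)"
    using T right_regular_in_commutant[OF \<open>group G\<close> t]
    by (simp add: group_vN_algebra_def commutant_def[of _ "commutant _ _"])
  finally show ?thesis
    using t bounded_ops_ell2[OF group_vN_algebra_bounded[OF T] delta_ell2[OF one_closed]]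
    by (simp add: right_regular_def fourier_coeff_def)
qed

text \<open>
  The column is \<open>x\<close> applied to \<open>\<delta>\<^sub>1 \<otimes> v\<close> and restricted to \<open>F\<close>. The row is the value at 1 of \<open>x\<close>
  applied to \<open>\<Sum>\<^sub>t \<delta>\<^bsub>t\<^sup>-\<^sup>1\<^esub> \<otimes> w\<^sub>t\<close>; the translates of the coefficients appear there
  because \<open>x\<close> commutes with right translations.
\<close>
lemma fourier_coeff_contr:
  fixes G (structure)
  assumes "group G" and F: "finite F" "F \<subseteq> carrier G"
    and x: "\<And>i j. i < m \<Longrightarrow> j < m \<Longrightarrow> x i j \<in> group_vN_algebra G"
    and norm: "mat_norm (carrier G) m x \<le> 1"
  shows "col_contr F m (\<lambda>t i j. fourier_coeff G (x i j) t)"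
    and "row_contr F m (\<lambda>t i j. fourier_coeff G (x i j) t)"
proof -
  interpret group G by fact
  note xb = group_vN_algebra_bounded[OF x]
  show "col_contr F m (\<lambda>t i j. fourier_coeff G (x i j) t)"
    unfolding col_contr_def
  proof
    fix v :: "nat \<Rightarrow> complex"
    define \<xi> where "\<xi> = (\<lambda>(b, j). if j < m then v j * delta \<one> b else 0)"
    have val: "mat_op m x \<xi> (t, i) = (\<Sum>j<m. fourier_coeff G (x i j) t * v j)" if "i < m" for t i
      using that bounded_ops_scale[OF xb delta_ell2[OF one_closed]]
      by (simp add: mat_op_def \<xi>_def fourier_coeff_def ac_simps)
    have "(\<Sum>t\<in>F. \<Sum>i<m. (cmod (\<Sum>j<m. fourier_coeff G (x i j) t * v j))\<^sup>2)
        = (\<Sum>p\<in>F \<times> {..<m}. (cmod (mat_op m x \<xi> p))\<^sup>2)"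
      unfolding sum.cartesian_product' by (simp add: val)
    also have "\<dots> \<le> (\<Sum>p\<in>{\<one>} \<times> {..<m}. (cmod (\<xi> p))\<^sup>2)"
      by (rule mat_op_contraction[OF xb norm]) (use F in \<open>auto simp: \<xi>_def delta_def split: if_splits\<close>)
    also have "\<dots> = (\<Sum>j<m. (cmod (v j))\<^sup>2)"
      unfolding sum.cartesian_product' by (simp add: \<xi>_def delta_def)
    finally show "(\<Sum>t\<in>F. \<Sum>i<m. (cmod (\<Sum>j<m. fourier_coeff G (x i j) t * v j))\<^sup>2)
        \<le> (\<Sum>j<m. (cmod (v j))\<^sup>2)" .
  qed
  show "row_contr F m (\<lambda>t i j. fourier_coeff G (x i j) t)"
    unfolding row_contr_def
  proof
    fix w :: "'a \<Rightarrow> nat \<Rightarrow> complex"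
    define \<xi> where "\<xi> = (\<lambda>(b, j). if j < m then \<Sum>t\<in>F. w t j * delta (inv t) b else 0)"
    have el: "delta (inv t) \<in> ell2 (carrier G)" if "t \<in> F" for t
      using that F by (intro delta_ell2) auto
    have val: "mat_op m x \<xi> (\<one>, i) = (\<Sum>t\<in>F. \<Sum>j<m. fourier_coeff G (x i j) t * w t j)"
      if i: "i < m" for i
    proof -
      have "mat_op m x \<xi> (\<one>, i) = (\<Sum>j<m. \<Sum>t\<in>F. w t j * x i j (delta (inv t)) \<one>)"
        using i bounded_ops_sum[OF xb el, where F = F and t1 = "\<lambda>t. t"]
        by (simp add: mat_op_def \<xi>_def)
      also have "\<dots> = (\<Sum>j<m. \<Sum>t\<in>F. fourier_coeff G (x i j) t * w t j)"
        using i F group_vN_algebra_delta_inv[OF \<open>group G\<close> x]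
        by (intro sum.cong refl) (auto simp: mult.commute)
      finally show ?thesis by (subst sum.swap)
    qed
    have at: "(\<Sum>t\<in>F. w t j * delta (inv t) (inv s)) = w s j" if s: "s \<in> F" for s j
    proof -
      have "w t j * delta (inv t) (inv s) = (if t = s then w t j else 0)" if "t \<in> F" for t
        using inv_inj s that F by (auto simp: delta_def inj_on_def)
      then show ?thesis using s F by (simp add: sum.delta cong: sum.cong)
    qed
    have "(\<Sum>i<m. (cmod (\<Sum>t\<in>F. \<Sum>j<m. fourier_coeff G (x i j) t * w t j))\<^sup>2)
        = (\<Sum>p\<in>{\<one>} \<times> {..<m}. (cmod (mat_op m x \<xi> p))\<^sup>2)"
      unfolding sum.cartesian_product' by (simp add: val)
    also have "\<dots> \<le> (\<Sum>p\<in>(\<lambda>t. inv t) ` F \<times> {..<m}. (cmod (\<xi> p))\<^sup>2)"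
    proof (rule mat_op_contraction[OF xb norm])
      show "\<xi> p = 0" if "p \<notin> (\<lambda>t. inv t) ` F \<times> {..<m}" for p
        using that by (cases p) (auto simp: \<xi>_def delta_def intro!: sum.neutral)
    qed (use F in auto)
    also have "\<dots> = (\<Sum>t\<in>F. \<Sum>j<m. (cmod (w t j))\<^sup>2)"
      unfolding sum.cartesian_product'
    proof (subst sum.reindex)
      show "inj_on (\<lambda>t. inv t) F" using inv_inj F(2) by (rule inj_on_subset)
      show "(\<Sum>t\<in>F. ((\<lambda>b. \<Sum>j<m. (cmod (\<xi> (b, j)))\<^sup>2) \<circ> (\<lambda>t. inv t)) t) = (\<Sum>t\<in>F. \<Sum>j<m. (cmod (w t j))\<^sup>2)"
        by (intro sum.cong refl) (simp add: \<xi>_def at)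
    qed
    finally show "(\<Sum>i<m. (cmod (\<Sum>t\<in>F. \<Sum>j<m. fourier_coeff G (x i j) t * w t j))\<^sup>2)
        \<le> (\<Sum>t\<in>F. \<Sum>j<m. (cmod (w t j))\<^sup>2)" .
  qed
qed

definition lin_reg :: "('g, 'b) monoid_scheme \<Rightarrow> 'g set \<Rightarrow> ('g \<Rightarrow> complex) \<Rightarrow> 'g op" where
  "lin_reg G F c = (\<lambda>\<xi> x. \<Sum>t\<in>F. c t * left_regular G t \<xi> x)"

lemma lin_reg_in_group_vN_algebra:
  assumes "group G" and F: "F \<subseteq> carrier G"
  shows "lin_reg G F c \<in> group_vN_algebra G"
proof -
  have lr: "left_regular G t \<in> bounded_ops (carrier G)" if "t \<in> F" for t
    using that F left_regular_in_bounded_ops[OF \<open>group G\<close>] by auto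
  have cl: "left_regular G t \<xi> \<in> ell2 (carrier G)" if "t \<in> F" for t \<xi>
    using bounded_ops_ell2[OF lr[OF that]]
    by (cases "\<xi> \<in> ell2 (carrier G)") (auto simp: left_regular_def ell2_zero)
  have "lin_reg G F c \<circ> R = R \<circ> lin_reg G F c"
    if R: "R \<in> commutant (carrier G) (left_regular G ` carrier G)" for R
  proof
    fix \<xi>
    have Rb: "R \<in> bounded_ops (carrier G)" using R by (simp add: commutant_def)
    have Rc: "R (left_regular G t \<xi>) = left_regular G t (R \<xi>)" if "t \<in> F" for t
    proof -
      have "R \<circ> left_regular G t = left_regular G t \<circ> R"
        using R that F by (auto simp: commutant_def)
      then show ?thesis by (metis comp_apply)
    qed
    have "R (lin_reg G F c \<xi>) = (\<lambda>x. \<Sum>t\<in>F. c t * R (left_regular G t \<xi>) x)"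
      unfolding lin_reg_def by (rule bounded_ops_sum[OF Rb cl])
    also have "\<dots> = lin_reg G F c (R \<xi>)"
      by (simp add: lin_reg_def Rc)
    finally show "(lin_reg G F c \<circ> R) \<xi> = (R \<circ> lin_reg G F c) \<xi>" by simp
  qed
  moreover have "lin_reg G F c \<in> bounded_ops (carrier G)"
    unfolding lin_reg_def by (rule bounded_ops_sum_closed[OF lr])
  ultimately show ?thesis
    by (simp add: group_vN_algebra_def commutant_def[of _ "commutant _ _"])
qed

lemma fourier_coeff_lin_reg:
  fixes G (structure)
  assumes "group G" and F: "finite F" "F \<subseteq> carrier G" and s: "s \<in> F"
  shows "fourier_coeff G (lin_reg G F c) s = c s"
proof -
  interpret group G by fact
  have "c t * left_regular G t (delta \<one>) s = (if t = s then c t else 0)" if t: "t \<in> F" for t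
  proof -
    have tc: "t \<in> carrier G" "s \<in> carrier G" using t s F by auto
    then have "inv t \<otimes> s = \<one> \<longleftrightarrow> t = s"
      by (metis inv_closed inv_equality inv_inv l_inv)
    then show ?thesis
      using tc delta_ell2[OF one_closed] by (simp add: left_regular_def delta_def)
  qed
  then show ?thesis
    using F s by (simp add: fourier_coeff_def lin_reg_def sum.delta cong: sum.cong)
qed

section \<open>Synthesis from contractive rows and columns\<close>

text \<open>
  Reduction to finite sets: finitely many entries of the image of a vector depend on finitely many
  entries of the vector.
\<close>
lemma mat_norm_lin_reg_le:
  fixes G :: "('g, 'b) monoid_scheme" (structure)
  assumes F: "finite F" and C: "0 \<le> C"
    and bound: "\<And>B \<xi>. finite B \<Longrightarrow> B \<subseteq> carrier G \<Longrightarrow>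
      (\<Sum>x\<in>B. \<Sum>i<m. (cmod (\<Sum>t\<in>F. \<Sum>j<m. a t i j * \<xi> (inv t \<otimes> x) j))\<^sup>2)
      \<le> C * (\<Sum>z\<in>(\<lambda>(t, x). inv t \<otimes> x) ` (F \<times> B). \<Sum>j<m. (cmod (\<xi> z j))\<^sup>2)"
  shows "mat_norm (carrier G) m (\<lambda>i j. lin_reg G F (\<lambda>t. a t i j)) \<le> ennreal (sqrt C)"
  unfolding mat_norm_def op_norm_def
proof (rule SUP_least, rule ennreal_leI, rule ell2_norm_le)
  let ?x = "\<lambda>i j. lin_reg G F (\<lambda>t. a t i j)"
  fix \<xi> :: "'g \<times> nat \<Rightarrow> complex" and B :: "('g \<times> nat) set"
  assume \<xi>: "\<xi> \<in> {\<xi> \<in> ell2 (carrier G \<times> {..<m}). ell2_norm \<xi> \<le> 1}" and B: "finite B"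
  then have \<xi>e: "\<xi> \<in> ell2 (carrier G \<times> {..<m})" by simp
  let ?B = "fst ` B \<inter> carrier G"
  let ?Z = "(\<lambda>(t, x). inv t \<otimes> x) ` (F \<times> ?B)"
  have val: "mat_op m ?x \<xi> (y, i) = (if y \<in> carrier G then \<Sum>t\<in>F. \<Sum>j<m. a t i j * \<xi> (inv t \<otimes> y, j) else 0)"
    if "i < m" for y i
    using that ell2_slice[OF \<xi>e]
    by (simp add: mat_op_def lin_reg_def left_regular_def sum.swap[of _ "{..<m}" F])
  have "(\<Sum>p\<in>B. (cmod (mat_op m ?x \<xi> p))\<^sup>2) \<le> (\<Sum>y\<in>fst ` B. \<Sum>i<m. (cmod (mat_op m ?x \<xi> (y, i)))\<^sup>2)"
    by (rule sum_le_sum_rectangle[OF B]) (auto simp: mat_op_def)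
  also have "\<dots> = (\<Sum>y\<in>?B. \<Sum>i<m. (cmod (\<Sum>t\<in>F. \<Sum>j<m. a t i j * \<xi> (inv t \<otimes> y, j)))\<^sup>2)"
    by (rule sum.mono_neutral_cong_right) (use B in \<open>auto simp: val\<close>)
  also have "\<dots> \<le> C * (\<Sum>z\<in>?Z. \<Sum>j<m. (cmod (\<xi> (z, j)))\<^sup>2)"
    by (rule bound) (use B in auto)
  also have "(\<Sum>z\<in>?Z. \<Sum>j<m. (cmod (\<xi> (z, j)))\<^sup>2) = (\<Sum>p\<in>?Z \<times> {..<m}. (cmod (\<xi> p))\<^sup>2)"
    by (simp add: sum.cartesian_product')
  also have "\<dots> \<le> (ell2_norm \<xi>)\<^sup>2"
    by (rule sum_le_ell2_norm[OF \<xi>e]) (use B F in auto)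
  also have "\<dots> \<le> 1"
    using \<xi> by (intro power_le_one) (auto simp: ell2_norm_nonneg)
  finally show "(\<Sum>p\<in>B. (cmod (mat_op m ?x \<xi> p))\<^sup>2) \<le> (sqrt C)\<^sup>2"
    using C by (simp add: mult_left_mono)
qed (simp add: C)

text \<open>
  In other words, the map that sends the basis of the intersection of row and column operator space to
  \<open>\<lambda>(F)\<close> has completely bounded norm at most \<open>C\<close>.
\<close>
definition reg_bound :: "('g, 'b) monoid_scheme \<Rightarrow> 'g set \<Rightarrow> real \<Rightarrow> bool" where
  "reg_bound G F C \<longleftrightarrow> (\<forall>m a. col_contr F m a \<longrightarrow> row_contr F m a \<longrightarrow>
     mat_norm (carrier G) m (\<lambda>i j. lin_reg G F (\<lambda>t. a t i j)) \<le> ennreal C)"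

lemma reg_bound_of_kernel_bound:
  assumes "group G" "finite F" "F \<subseteq> carrier G" "0 \<le> C"
    and "kernel_bound G (\<lambda>t. of_bool (t \<in> F)) C"
  shows "reg_bound G F (sqrt C)"
  unfolding reg_bound_def
proof (intro allI impI)
  fix m a
  assume a: "col_contr F m a" "row_contr F m a"
  show "mat_norm (carrier G) m (\<lambda>i j. lin_reg G F (\<lambda>t. a t i j)) \<le> ennreal (sqrt C)"
    by (rule mat_norm_lin_reg_le[OF assms(2,4)]) (rule group_block_bound[OF assms a _ _ refl])
qed

lemma inv_free_gen:
  assumes "i < n"
  shows "inv\<^bsub>free_group n\<^esub> free_gen i = [(i, False)]"
proof -
  interpret group "free_group n" by (rule group_free_group)
  show ?thesis
    by (rule inv_equality) (use assms in \<open>auto simp: free_group_def inv_letter_def reduced_Cons\<close>)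
qed

text \<open>
  The operator \<open>\<Sum>\<^sub>l \<lambda>(g\<^sub>l) \<otimes> a\<^sub>l\<close> is split according to whether the output word \<open>w\<close> begins with \<open>g\<^sub>l\<close>. If it
  does, \<open>w\<close> determines \<open>l\<close>, and the column bound applies. If it does not, the input word \<open>g\<^sub>l\<^sup>-\<^sup>1 w\<close>
  begins with \<open>g\<^sub>l\<^sup>-\<^sup>1\<close> and determines \<open>l\<close> and \<open>w\<close>, and the row bound applies. Each part is a
  contraction.
\<close>
lemma haagerup_inequality:
  fixes n :: nat
  defines "gens \<equiv> free_gen ` {..<n}"
  shows "reg_bound (free_group n) gens 2"
  unfolding reg_bound_def
proof (intro allI impI)
  fix m a
  assume col: "col_contr gens m a" and row: "row_contr gens m a"
  let ?g = "\<lambda>l::nat. free_gen l"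
  have gens: "finite gens" "gens \<subseteq> carrier (free_group n)"
    by (auto simp: gens_def free_group_def reduced_Cons)
  have inj: "inj_on ?g {..<n}" by (auto simp: inj_on_def)
  have gsum: "(\<Sum>t\<in>gens. f t) = (\<Sum>l<n. f (?g l))" for f :: "letter list \<Rightarrow> 'x::comm_monoid_add"
    by (simp add: gens_def sum.reindex[OF inj])
  have shift: "inv\<^bsub>free_group n\<^esub> (?g l) \<otimes>\<^bsub>free_group n\<^esub> w = push_letter (l, False) w" if "l < n" for l w
    unfolding inv_free_gen[OF that] by (simp add: free_group_def)
  have "mat_norm (carrier (free_group n)) m (\<lambda>i j. lin_reg (free_group n) gens (\<lambda>t. a t i j)) \<le> ennreal (sqrt 4)"
  proof (rule mat_norm_lin_reg_le[OF gens(1)])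
    fix B and \<xi> :: "letter list \<Rightarrow> nat \<Rightarrow> complex"
    assume B: "finite B" "B \<subseteq> carrier (free_group n)"
    let ?Z = "(\<lambda>(t, w). inv\<^bsub>free_group n\<^esub> t \<otimes>\<^bsub>free_group n\<^esub> w) ` (gens \<times> B)"
    define Z where "Z = ?Z"
    have Z: "finite Z" using gens B by (simp add: Z_def)
    have ZI: "push_letter (l, False) w \<in> Z" if "l < n" "w \<in> B" for l w
      unfolding Z_def shift[OF that(1), of w, symmetric]
      by (rule image_eqI[of _ _ "(free_gen l, w)"]) (use that in \<open>auto simp: gens_def\<close>)
    define N where "N z = (\<Sum>j<m. (cmod (\<xi> z j))\<^sup>2)" for z
    have N0: "0 \<le> N z" for z by (simp add: N_def sum_nonneg)
    define T where "T w l i = (\<Sum>j<m. a (?g l) i j * \<xi> (push_letter (l, False) w) j)" for w l i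
    define st where "st w l \<longleftrightarrow> (\<exists>w'. w = (l, True) # w')" for w :: "letter list" and l
    have push: "push_letter (l, False) w = (l, False) # w" if "\<not> st w l" for w l
      using that by (cases w) (auto simp: st_def inv_letter_def)
    define D1 where "D1 w i = (\<Sum>l<n. of_bool (st w l) * T w l i)" for w i
    define D2 where "D2 w i = (\<Sum>l<n. of_bool (\<not> st w l) * T w l i)" for w i
    have split: "(\<Sum>t\<in>gens. \<Sum>j<m. a t i j * \<xi> (inv\<^bsub>free_group n\<^esub> t \<otimes>\<^bsub>free_group n\<^esub> w) j) = D1 w i + D2 w i"
      for w i
      unfolding gsum D1_def D2_def sum.distrib[symmetric]
      by (intro sum.cong refl) (auto simp: shift T_def)
    have sq: "(cmod (D1 w i + D2 w i))\<^sup>2 \<le> 2 * (cmod (D1 w i))\<^sup>2 + 2 * (cmod (D2 w i))\<^sup>2" for w i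
    proof -
      have "(cmod (D1 w i + D2 w i))\<^sup>2 \<le> (cmod (D1 w i) + cmod (D2 w i))\<^sup>2"
        by (intro power_mono norm_triangle_ineq) simp
      then show ?thesis
        using sum_squares_bound[of "cmod (D1 w i)" "cmod (D2 w i)"] by (simp add: power2_sum)
    qed
    have D1: "(\<Sum>w\<in>B. \<Sum>i<m. (cmod (D1 w i))\<^sup>2) \<le> (\<Sum>z\<in>Z. N z)"
    proof -
      define A where "A = {(w, l). w \<in> B \<and> l < n \<and> st w l}"
      have A: "finite A" by (rule finite_subset[of _ "B \<times> {..<n}"]) (use B in \<open>auto simp: A_def\<close>)
      let ?S = "\<lambda>l z. \<Sum>i<m. (cmod (\<Sum>j<m. a (?g l) i j * \<xi> z j))\<^sup>2"
      have "(\<Sum>w\<in>B. \<Sum>i<m. (cmod (D1 w i))\<^sup>2) = (\<Sum>w\<in>B. \<Sum>l<n. \<Sum>i<m. of_bool (st w l) * (cmod (T w l i))\<^sup>2)"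
      proof (rule sum.cong[OF refl])
        fix w
        have "(cmod (D1 w i))\<^sup>2 = (\<Sum>l<n. of_bool (st w l) * (cmod (T w l i))\<^sup>2)" for i
        proof (cases "\<exists>l<n. st w l")
          case True
          then obtain l where l: "l < n" "st w l" by blast
          then have iff: "st w k \<longleftrightarrow> k = l" for k by (auto simp: st_def)
          have delta: "(\<Sum>k<n. of_bool (st w k) * f k) = f l" for f :: "nat \<Rightarrow> 'x::comm_semiring_1"
          proof -
            have "(\<Sum>k<n. of_bool (st w k) * f k) = (\<Sum>k<n. if k = l then f k else 0)"
              by (intro sum.cong) (auto simp: iff)
            then show ?thesis using l(1) by (simp add: sum.delta)
          qed
          show ?thesis unfolding D1_def delta ..
        qed (simp add: D1_def)
        then show "(\<Sum>i<m. (cmod (D1 w i))\<^sup>2) = (\<Sum>l<n. \<Sum>i<m. of_bool (st w l) * (cmod (T w l i))\<^sup>2)"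
          by (simp only: sum.swap[of _ "{..<m}"])
      qed
      also have "\<dots> = (\<Sum>(w, l)\<in>B \<times> {..<n}. of_bool (st w l) * ?S l (push_letter (l, False) w))"
        by (simp add: sum.cartesian_product T_def sum_distrib_left)
      also have "\<dots> = (\<Sum>(w, l)\<in>A. ?S l (push_letter (l, False) w))"
        by (rule sum.mono_neutral_cong_right) (use B in \<open>auto simp: A_def\<close>)
      also have "\<dots> = (\<Sum>(l, z)\<in>(\<lambda>(w, l). (l, push_letter (l, False) w)) ` A. ?S l z)"
        by (subst sum.reindex) (auto simp: inj_on_def A_def st_def inv_letter_def intro!: sum.cong)
      also have "\<dots> \<le> (\<Sum>(l, z)\<in>{..<n} \<times> Z. ?S l z)"
        by (rule sum_mono2) (use A Z ZI in \<open>auto simp: A_def sum_nonneg\<close>)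
      also have "\<dots> = (\<Sum>z\<in>Z. \<Sum>l<n. ?S l z)"
        by (simp add: sum.cartesian_product[symmetric] sum.swap[of _ Z])
      also have "\<dots> \<le> (\<Sum>z\<in>Z. N z)"
        using col unfolding col_contr_def gsum N_def by (intro sum_mono) blast
      finally show ?thesis .
    qed
    have D2: "(\<Sum>w\<in>B. \<Sum>i<m. (cmod (D2 w i))\<^sup>2) \<le> (\<Sum>z\<in>Z. N z)"
    proof -
      define u where "u w t j = of_bool (\<not> st w (fst (hd t))) * \<xi> (push_letter (fst (hd t), False) w) j"
        for w and t :: "letter list" and j
      have D2u: "D2 w i = (\<Sum>t\<in>gens. \<Sum>j<m. a t i j * u w t j)" for w i
        unfolding gsum D2_def T_def u_def sum_distrib_left by (intro sum.cong refl) simp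
      have "(\<Sum>w\<in>B. \<Sum>i<m. (cmod (D2 w i))\<^sup>2) \<le> (\<Sum>w\<in>B. \<Sum>t\<in>gens. \<Sum>j<m. (cmod (u w t j))\<^sup>2)"
        using row unfolding row_contr_def D2u by (intro sum_mono) blast
      also have "\<dots> = (\<Sum>(w, l)\<in>B \<times> {..<n}. of_bool (\<not> st w l) * N (push_letter (l, False) w))"
        unfolding gsum sum.cartesian_product[symmetric]
        by (intro sum.cong refl) (simp add: u_def N_def norm_mult power_mult_distrib of_bool_def)
      also have "\<dots> = (\<Sum>(w, l)\<in>{(w, l). w \<in> B \<and> l < n \<and> \<not> st w l}. N ((l, False) # w))"
        by (rule sum.mono_neutral_cong_right) (use B in \<open>auto simp: push\<close>)
      also have "\<dots> = (\<Sum>z\<in>(\<lambda>(w, l). (l, False) # w) ` {(w, l). w \<in> B \<and> l < n \<and> \<not> st w l}. N z)"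
        by (subst sum.reindex) (auto simp: inj_on_def intro!: sum.cong)
      also have "\<dots> \<le> (\<Sum>z\<in>Z. N z)"
        by (rule sum_mono2) (use Z ZI push in \<open>force simp: N0\<close>)+
      finally show ?thesis .
    qed
    have "(\<Sum>w\<in>B. \<Sum>i<m. (cmod (\<Sum>t\<in>gens. \<Sum>j<m. a t i j * \<xi> (inv\<^bsub>free_group n\<^esub> t \<otimes>\<^bsub>free_group n\<^esub> w) j))\<^sup>2)
        \<le> (\<Sum>w\<in>B. \<Sum>i<m. 2 * (cmod (D1 w i))\<^sup>2 + 2 * (cmod (D2 w i))\<^sup>2)"
      unfolding split by (intro sum_mono sq)
    also have "\<dots> = 2 * (\<Sum>w\<in>B. \<Sum>i<m. (cmod (D1 w i))\<^sup>2) + 2 * (\<Sum>w\<in>B. \<Sum>i<m. (cmod (D2 w i))\<^sup>2)"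
      by (simp add: sum.distrib sum_distrib_left)
    also have "\<dots> \<le> 4 * (\<Sum>z\<in>Z. N z)" using D1 D2 by simp
    finally show "(\<Sum>w\<in>B. \<Sum>i<m. (cmod (\<Sum>t\<in>gens. \<Sum>j<m.
          a t i j * \<xi> (inv\<^bsub>free_group n\<^esub> t \<otimes>\<^bsub>free_group n\<^esub> w) j))\<^sup>2)
        \<le> 4 * (\<Sum>z\<in>?Z. \<Sum>j<m. (cmod (\<xi> z j))\<^sup>2)"
      by (simp add: Z_def N_def)
  qed simp
  then show "mat_norm (carrier (free_group n)) m (\<lambda>i j. lin_reg (free_group n) gens (\<lambda>t. a t i j)) \<le> ennreal 2"
    by simp
qed

section \<open>Factorization of the identity\<close>

text \<open>
  Both maps of the factorization are of this form, with the roles of the two groups exchanged.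
\<close>
lemma fourier_transfer_cb_norm:
  assumes G: "group G" and F: "finite F" "F \<subseteq> carrier G"
    and \<beta>: "bij_betw \<beta> F' F"
    and bound: "reg_bound H F' C"
    and E: "E \<subseteq> group_vN_algebra G"
  shows "cb_norm (carrier G) E (carrier H) (\<lambda>T. lin_reg H F' (\<lambda>t. fourier_coeff G T (\<beta> t))) \<le> ennreal C"
  unfolding cb_norm_def
proof (intro SUP_least)
  fix m :: nat and x
  assume x: "x \<in> {x. (\<forall>i<m. \<forall>j<m. x i j \<in> E) \<and> mat_norm (carrier G) m x \<le> 1}"
  then have xv: "x i j \<in> group_vN_algebra G" if "i < m" "j < m" for i j using that E by auto
  have norm: "mat_norm (carrier G) m x \<le> 1" using x by simp
  note contr = fourier_coeff_contr[OF G F xv norm]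
  let ?a = "\<lambda>t i j. fourier_coeff G (x i j) (\<beta> t)"
  have "col_contr F' m ?a"
    unfolding col_contr_def
  proof
    fix v :: "nat \<Rightarrow> complex"
    show "(\<Sum>t\<in>F'. \<Sum>i<m. (cmod (\<Sum>j<m. fourier_coeff G (x i j) (\<beta> t) * v j))\<^sup>2) \<le> (\<Sum>j<m. (cmod (v j))\<^sup>2)"
      using contr(1) sum.reindex_bij_betw[OF \<beta>, of "\<lambda>t. \<Sum>i<m. (cmod (\<Sum>j<m. fourier_coeff G (x i j) t * v j))\<^sup>2"]
      by (simp add: col_contr_def)
  qed
  moreover have "row_contr F' m ?a"
    unfolding row_contr_def
  proof
    fix w :: "'c \<Rightarrow> nat \<Rightarrow> complex"
    \<comment> \<open>The family \<open>w\<close> on \<open>F'\<close> is transported to \<open>F\<close> in order to apply the row bound there.\<close>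
    define w' where "w' = w \<circ> inv_into F' \<beta>"
    have w: "w t = w' (\<beta> t)" if "t \<in> F'" for t
      using that \<beta> by (simp add: w'_def bij_betw_def)
    have "(\<Sum>i<m. (cmod (\<Sum>t\<in>F'. \<Sum>j<m. fourier_coeff G (x i j) (\<beta> t) * w t j))\<^sup>2)
      = (\<Sum>i<m. (cmod (\<Sum>t\<in>F. \<Sum>j<m. fourier_coeff G (x i j) t * w' t j))\<^sup>2)"
      using sum.reindex_bij_betw[OF \<beta>, of "\<lambda>t. \<Sum>j<m. fourier_coeff G (x _ j) t * w' t j"]
      by (simp add: w)
    also have "\<dots> \<le> (\<Sum>t\<in>F. \<Sum>j<m. (cmod (w' t j))\<^sup>2)"
      using contr(2) by (simp add: row_contr_def)
    also have "\<dots> = (\<Sum>t\<in>F'. \<Sum>j<m. (cmod (w t j))\<^sup>2)"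
      using sum.reindex_bij_betw[OF \<beta>, of "\<lambda>t. \<Sum>j<m. (cmod (w' t j))\<^sup>2"] by (simp add: w)
    finally show "(\<Sum>i<m. (cmod (\<Sum>t\<in>F'. \<Sum>j<m. fourier_coeff G (x i j) (\<beta> t) * w t j))\<^sup>2)
      \<le> (\<Sum>t\<in>F'. \<Sum>j<m. (cmod (w t j))\<^sup>2)" .
  qed
  ultimately show "mat_norm (carrier H) m (\<lambda>i j. lin_reg H F' (\<lambda>t. fourier_coeff G (x i j) (\<beta> t))) \<le> ennreal C"
    using bound by (simp add: reg_bound_def)
qed

lemma linear_map_on_transfer:
  "linear_map_on E (\<lambda>T. lin_reg H F' (\<lambda>t. fourier_coeff G T (\<beta> t)))"
proof -
  have "(\<Sum>t\<in>F'. (a * s t + b * r t) * l t) = a * (\<Sum>t\<in>F'. s t * l t) + b * (\<Sum>t\<in>F'. r t * l t)"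
    for a b :: complex and s r l
    by (simp add: sum_distrib_left sum.distrib distrib_right mult.assoc)
  then show ?thesis unfolding linear_map_on_def lin_reg_def fourier_coeff_def by simp
qed

text \<open>
  The factor 2 is the free group's constant in Haagerup's inequality, and \<open>\<surd>C\<close> is the bound for the
  map that replaces the free generators by the elements of \<open>F\<close>.
\<close>
lemma gamma_vN_le:
  assumes G: "group G" and F: "finite F" "F \<subseteq> carrier G"
    and C: "0 \<le> C" and kb: "kernel_bound G (\<lambda>t. of_bool (t \<in> F)) C"
  shows "gamma_vN G (card F) \<le> ennreal (2 * sqrt C)"
proof -
  define n where "n = card F"
  define gens where "gens = free_gen ` {..<n}"
  let ?H = "free_group n"
  have H: "group ?H" by (rule group_free_group)
  have gens: "finite gens" "gens \<subseteq> carrier ?H"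
    by (auto simp: gens_def free_group_def reduced_Cons)
  have inj: "inj_on (\<lambda>l::nat. free_gen l) {..<n}" by (auto simp: inj_on_def)
  have "card gens = card F" unfolding gens_def card_image[OF inj] by (simp add: n_def)
  then obtain \<beta> where \<beta>: "bij_betw \<beta> gens F"
    using gens F finite_same_card_bij by blast
  define \<beta>' where "\<beta>' = inv_into gens \<beta>"
  have \<beta>': "bij_betw \<beta>' F gens" using \<beta> by (simp add: \<beta>'_def bij_betw_inv_into)
  define u where "u = (\<lambda>T. lin_reg G F (\<lambda>t. fourier_coeff ?H T (\<beta>' t)))"
  define v where "v = (\<lambda>T. lin_reg ?H gens (\<lambda>t. fourier_coeff G T (\<beta> t)))"
  have span: "lin_reg ?H gens c \<in> free_gen_span n" for c
    unfolding free_gen_span_def lin_reg_def gens_def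
    by (auto simp: sum.reindex[OF inj] intro!: exI[of _ "\<lambda>l. c (free_gen l)"])
  have span': "\<exists>c. T = lin_reg ?H gens c" if T: "T \<in> free_gen_span n" for T
  proof -
    obtain c where "T = (\<lambda>\<xi> w. \<Sum>i<n. c i * left_regular ?H (free_gen i) \<xi> w)"
      using T by (auto simp: free_gen_span_def)
    then have "T = lin_reg ?H gens (\<lambda>t. c (fst (hd t)))"
      by (simp add: lin_reg_def gens_def sum.reindex[OF inj])
    then show ?thesis by blast
  qed
  have E: "free_gen_span n \<subseteq> group_vN_algebra ?H"
    using span' lin_reg_in_group_vN_algebra[OF H gens(2)] by blast
  have cu: "cb_norm (carrier ?H) (free_gen_span n) (carrier G) u \<le> ennreal (sqrt C)"
    unfolding u_def
    by (rule fourier_transfer_cb_norm[OF H gens \<beta>' reg_bound_of_kernel_bound[OF G F C kb] E])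
  have cv: "cb_norm (carrier G) (group_vN_algebra G) (carrier ?H) v \<le> ennreal 2"
    unfolding v_def
    by (rule fourier_transfer_cb_norm[OF G F \<beta> haagerup_inequality[of n, folded gens_def] order.refl])
  have mu: "u \<in> cb_maps (carrier ?H) (free_gen_span n) (carrier G) (group_vN_algebra G)"
    using le_less_trans[OF cu ennreal_less_top] lin_reg_in_group_vN_algebra[OF G F(2)]
    by (auto simp: cb_maps_def u_def linear_map_on_transfer)
  have mv: "v \<in> cb_maps (carrier G) (group_vN_algebra G) (carrier ?H) (free_gen_span n)"
    using le_less_trans[OF cv ennreal_less_top] span
    by (auto simp: cb_maps_def v_def linear_map_on_transfer)
  have id: "v (u T) = T" if T: "T \<in> free_gen_span n" for T
  proof -
    obtain c where T: "T = lin_reg ?H gens c" using span'[OF T] by blast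
    have "fourier_coeff G (u T) (\<beta> t) = c t" if t: "t \<in> gens" for t
    proof -
      have "\<beta> t \<in> F" "\<beta>' (\<beta> t) = t"
        using t \<beta> by (auto simp: bij_betw_def \<beta>'_def)
      then show ?thesis
        using t by (simp add: u_def T fourier_coeff_lin_reg[OF G F] fourier_coeff_lin_reg[OF H gens])
    qed
    then show ?thesis unfolding v_def lin_reg_def T by (simp add: fun_eq_iff)
  qed
  have "gamma_vN G n \<le> cb_norm (carrier ?H) (free_gen_span n) (carrier G) u
      * cb_norm (carrier G) (group_vN_algebra G) (carrier ?H) v"
    unfolding gamma_vN_def factorization_const_def
    by (rule INF_lower2[of "(u, v)"]) (use mu mv id in auto)
  also have "\<dots> \<le> ennreal (sqrt C) * ennreal 2"
    by (intro mult_mono cu cv) auto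
  also have "\<dots> = ennreal (2 * sqrt C)"
    using ennreal_mult'[of 2 "sqrt C"] by (simp add: mult.commute)
  finally show ?thesis by (simp add: n_def)
qed

section \<open>Kesten's theorem\<close>

text \<open>
  The set \<open>W\<close> need only contain all points that are translated into the support of \<open>\<phi>\<close>.
\<close>
lemma sum_translate:
  fixes G (structure) and \<phi> :: "_ \<Rightarrow> 'x::comm_monoid_add"
  assumes "group G" and s: "s \<in> carrier G" and A: "A \<subseteq> carrier G"
    and \<phi>: "\<And>y. y \<in> carrier G \<Longrightarrow> y \<notin> A \<Longrightarrow> \<phi> y = 0"
    and W: "finite W" "W \<subseteq> carrier G" "(\<lambda>y. inv s \<otimes> y) ` A \<subseteq> W"
  shows "(\<Sum>x\<in>W. \<phi> (s \<otimes> x)) = (\<Sum>y\<in>A. \<phi> y)"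
proof -
  interpret group G by fact
  have cancel: "s \<otimes> (inv s \<otimes> y) = y" "inv s \<otimes> (s \<otimes> y) = y" if "y \<in> carrier G" for y
    using s that by (simp_all add: m_assoc[symmetric])
  have "(\<Sum>x\<in>W. \<phi> (s \<otimes> x)) = (\<Sum>x\<in>(\<lambda>y. inv s \<otimes> y) ` A. \<phi> (s \<otimes> x))"
  proof (rule sum.mono_neutral_right[OF W(1,3)], rule ballI)
    fix x assume x: "x \<in> W - (\<lambda>y. inv s \<otimes> y) ` A"
    then have xc: "x \<in> carrier G" using W by auto
    have "s \<otimes> x \<notin> A"
    proof
      assume "s \<otimes> x \<in> A"
      then have "inv s \<otimes> (s \<otimes> x) \<in> (\<lambda>y. inv s \<otimes> y) ` A" by (rule imageI)
      then show False using x cancel(2)[OF xc] by simp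
    qed
    then show "\<phi> (s \<otimes> x) = 0" using \<phi> s xc by simp
  qed
  also have "\<dots> = (\<Sum>y\<in>A. \<phi> (s \<otimes> (inv s \<otimes> y)))"
  proof (subst sum.reindex)
    show "inj_on (\<lambda>y. inv s \<otimes> y) A"
      using A cancel(1) by (intro inj_onI) (metis subsetD)
  qed simp
  also have "\<dots> = (\<Sum>y\<in>A. \<phi> y)"
    using A cancel(1) by (intro sum.cong) auto
  finally show ?thesis .
qed

text \<open>
  The probability densities \<open>p\<close> define means that become invariant as \<open>S\<close> grows and \<open>\<epsilon>\<close> shrinks. On each
  bounded function \<open>h\<close> they take values in a compact interval, so by Tychonoff's theorem they have a cluster
  point \<open>M\<close>. Along the filter \<open>\<G>\<close> of pairs \<open>(S, k)\<close> whose means approach \<open>M\<close> the values at every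
  \<open>h\<close> converge, and the properties of a mean pass to the limit.
\<close>
lemma amenable_of_reiter:
  fixes G :: "('g, 'b) monoid_scheme" (structure)
  assumes "group G"
    and reiter: "\<And>S \<epsilon>. finite S \<Longrightarrow> S \<subseteq> carrier G \<Longrightarrow> 0 < \<epsilon> \<Longrightarrow>
      \<exists>A p. finite A \<and> A \<subseteq> carrier G \<and> (\<forall>x. 0 \<le> p x) \<and> (\<forall>x. x \<notin> A \<longrightarrow> p x = 0) \<and> sum p A = (1::real) \<and>
        (\<forall>s\<in>S. (\<Sum>x\<in>A \<union> (\<lambda>y. inv s \<otimes> y) ` A. \<bar>p (s \<otimes> x) - p x\<bar>) \<le> \<epsilon>)"
  shows "amenable G"
proof -
  interpret group G by fact
  let ?valid = "\<lambda>q :: 'g set \<times> nat. finite (fst q) \<and> fst q \<subseteq> carrier G"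
  define good where "good q A p \<longleftrightarrow> finite A \<and> A \<subseteq> carrier G \<and> (\<forall>x. 0 \<le> p x) \<and> (\<forall>x. x \<notin> A \<longrightarrow> p x = 0) \<and> sum p A = (1::real) \<and>
      (\<forall>s\<in>fst q. (\<Sum>x\<in>A \<union> (\<lambda>y. inv s \<otimes> y) ` A. \<bar>p (s \<otimes> x) - p x\<bar>) \<le> 1 / Suc (snd q))"
    for q :: "'g set \<times> nat" and A p
  have "\<forall>q. \<exists>z. ?valid q \<longrightarrow> good q (fst z) (snd z)"
  proof
    fix q
    show "\<exists>z. ?valid q \<longrightarrow> good q (fst z) (snd z)"
    proof (cases "?valid q")
    case True
    then have "\<exists>A p. good q A p"
      using reiter[of "fst q" "1 / Suc (snd q)"] unfolding good_def by simp
    then show ?thesis by auto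
    qed blast
  qed
  from choice[OF this] obtain z
    where "\<And>q. ?valid q \<Longrightarrow> good q (fst (z q)) (snd (z q))" by blast
  moreover define A where "A q = fst (z q)" for q
  moreover define p where "p q = snd (z q)" for q
  ultimately have "\<And>q. ?valid q \<Longrightarrow> good q (A q) (p q)" by simp
  note Ap = this[unfolded good_def]
  have Afin: "finite (A q)" and Asub: "A q \<subseteq> carrier G" and p0: "0 \<le> p q x"
    and psupp: "x \<notin> A q \<Longrightarrow> p q x = 0" and psum: "sum (p q) (A q) = 1"
    and pinv: "s \<in> fst q \<Longrightarrow> (\<Sum>x\<in>A q \<union> (\<lambda>y. inv s \<otimes> y) ` A q. \<bar>p q (s \<otimes> x) - p q x\<bar>) \<le> 1 / Suc (snd q)"
    if "?valid q" for q x s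
    using Ap[OF that] by simp_all
  let ?bdd = "\<lambda>h :: 'g \<Rightarrow> real. bounded (h ` carrier G)"
  define \<mu> where "\<mu> q h = (if ?bdd h then \<Sum>x\<in>A q. h x * p q x else 0)" for q h
  have "\<exists>b. 0 \<le> b \<and> (?bdd h \<longrightarrow> (\<forall>x\<in>carrier G. \<bar>h x\<bar> \<le> b))" for h
  proof (cases "?bdd h")
    case True
    then obtain c where "\<forall>y\<in>h ` carrier G. norm y \<le> c" unfolding bounded_iff by blast
    then show ?thesis by (intro exI[of _ "max 0 c"]) (auto simp: max_def dest: order.trans)
  qed auto
  then obtain b where b0: "\<And>h. 0 \<le> b h" and b: "\<And>h x. ?bdd h \<Longrightarrow> x \<in> carrier G \<Longrightarrow> \<bar>h x\<bar> \<le> b h"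
    by metis
  have \<mu>_le: "\<bar>\<mu> q h\<bar> \<le> b h" if "?valid q" for q h
  proof (cases "?bdd h")
    case True
    have "\<bar>\<Sum>x\<in>A q. h x * p q x\<bar> \<le> (\<Sum>x\<in>A q. \<bar>h x * p q x\<bar>)" by (rule sum_abs)
    also have "\<dots> \<le> (\<Sum>x\<in>A q. b h * p q x)"
    proof (rule sum_mono)
      fix x assume "x \<in> A q"
      from b[OF True subsetD[OF Asub[OF that] this]] show "\<bar>h x * p q x\<bar> \<le> b h * p q x"
        using p0[OF that, of x] by (simp add: abs_mult mult_right_mono)
    qed
    also have "\<dots> = b h" using psum[OF that] by (simp add: sum_distrib_left[symmetric])
    finally show ?thesis using True by (simp add: \<mu>_def)
  qed (simp add: \<mu>_def b0)
  define \<F> where "\<F> = finite_subsets_at_top (carrier G) \<times>\<^sub>F (sequentially :: nat filter)"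
  have \<F>: "\<F> \<noteq> bot" by (simp add: \<F>_def prod_filter_eq_bot)
  have ev_S: "eventually (\<lambda>q. ?valid q \<and> g \<in> fst q) \<F>" if "g \<in> carrier G" for g
  proof -
    have "eventually (\<lambda>S. finite S \<and> S \<subseteq> carrier G \<and> g \<in> S) (finite_subsets_at_top (carrier G))"
      unfolding eventually_finite_subsets_at_top by (rule exI[of _ "{g}"]) (use that in auto)
    then have "eventually (\<lambda>q. finite (fst q) \<and> fst q \<subseteq> carrier G \<and> g \<in> fst q) \<F>"
      unfolding \<F>_def by (rule eventually_compose_filterlim[OF _ filterlim_fst])
    then show ?thesis by (rule eventually_mono) auto
  qed
  have ev: "eventually ?valid \<F>"
    by (rule eventually_mono[OF ev_S[OF one_closed]]) auto
  define K where "K = (\<Pi>\<^sub>E h\<in>UNIV. {- b h..b h})"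
  have "compactin (product_topology (\<lambda>h. euclidean) UNIV) K"
    unfolding K_def compactin_PiE by (simp add: compactin_euclidean_iff)
  then have "compact K" by (simp add: euclidean_product_topology compactin_euclidean_iff)
  moreover have "filtermap \<mu> \<F> \<noteq> bot" using \<F> by (simp add: filtermap_bot_iff)
  moreover have "eventually (\<lambda>x. x \<in> K) (filtermap \<mu> \<F>)"
    unfolding eventually_filtermap
  proof (rule eventually_mono[OF ev])
    fix q assume "?valid q"
    from \<mu>_le[OF this] show "\<mu> q \<in> K" by (simp add: K_def PiE_iff abs_le_iff minus_le_iff)
  qed
  ultimately obtain M where M: "inf (nhds M) (filtermap \<mu> \<F>) \<noteq> bot"
    unfolding compact_filter by blast
  \<comment> \<open>Subsequences do not suffice for the cluster point of a net; restricting the filter replaces them.\<close>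
  define \<G> where "\<G> = inf (filtercomap \<mu> (nhds M)) \<F>"
  have \<G>: "\<G> \<noteq> bot"
  proof
    assume "\<G> = bot"
    then have "eventually (\<lambda>_. False) \<G>" by simp
    then obtain P Q where PQ: "eventually P (filtercomap \<mu> (nhds M))" "eventually Q \<F>" "\<And>q. P q \<Longrightarrow> Q q \<Longrightarrow> False"
      unfolding \<G>_def eventually_inf by blast
    obtain R where R: "eventually R (nhds M)" "\<And>q. R (\<mu> q) \<Longrightarrow> P q"
      using PQ(1) unfolding eventually_filtercomap by blast
    have "eventually (\<lambda>y. \<exists>q. y = \<mu> q \<and> Q q) (filtermap \<mu> \<F>)"
      unfolding eventually_filtermap by (rule eventually_mono[OF PQ(2)]) blast
    then have "eventually (\<lambda>_. False) (inf (nhds M) (filtermap \<mu> \<F>))"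
      unfolding eventually_inf using R PQ(3) by blast
    then show False using M by (simp add: trivial_limit_def)
  qed
  have lim: "((\<lambda>q. \<mu> q h) \<longlongrightarrow> M h) \<G>" for h
  proof -
    have "(\<mu> \<longlongrightarrow> M) \<G>"
      unfolding \<G>_def by (rule filterlim_mono[OF filterlim_filtercomap order.refl inf_le1])
    then show ?thesis
      by (rule continuous_on_tendsto_compose[OF continuous_on_product_coordinates[of h]]) auto
  qed
  have evG: "eventually P \<G>" if "eventually P \<F>" for P
    unfolding \<G>_def by (rule filter_leD[OF inf_le2 that])
  show ?thesis
    unfolding amenable_def
  proof (intro exI[of _ M] conjI allI impI ballI)
    fix f h :: "'g \<Rightarrow> real" and c d :: real
    assume fh: "?bdd f" "?bdd h"
    have "\<bar>c * f x + d * h x\<bar> \<le> \<bar>c\<bar> * b f + \<bar>d\<bar> * b h" if "x \<in> carrier G" for x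
      using mult_left_mono[OF b[OF fh(1) that], of "\<bar>c\<bar>"] mult_left_mono[OF b[OF fh(2) that], of "\<bar>d\<bar>"]
        abs_triangle_ineq[of "c * f x" "d * h x"] by (simp add: abs_mult)
    then have "?bdd (\<lambda>x. c * f x + d * h x)" unfolding bounded_iff by auto
    then have "\<mu> q (\<lambda>x. c * f x + d * h x) = c * \<mu> q f + d * \<mu> q h" for q
      using fh by (simp add: \<mu>_def sum_distrib_left sum.distrib algebra_simps)
    then have "((\<lambda>q. c * \<mu> q f + d * \<mu> q h) \<longlongrightarrow> M (\<lambda>x. c * f x + d * h x)) \<G>"
      using lim[of "\<lambda>x. c * f x + d * h x"] by simp
    moreover have "((\<lambda>q. c * \<mu> q f + d * \<mu> q h) \<longlongrightarrow> c * M f + d * M h) \<G>"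
      by (intro tendsto_intros lim)
    ultimately show "M (\<lambda>x. c * f x + d * h x) = c * M f + d * M h"
      using tendsto_unique[OF \<G>] by blast
  next
    fix f :: "'g \<Rightarrow> real"
    assume f: "?bdd f" "\<forall>x\<in>carrier G. 0 \<le> f x"
    have "0 \<le> \<mu> q f" if "?valid q" for q
      using f(1) sum_nonneg[OF mult_nonneg_nonneg[OF f(2)[rule_format, OF subsetD[OF Asub[OF that]]] p0[OF that]]]
      by (simp add: \<mu>_def)
    then have "eventually (\<lambda>q. 0 \<le> \<mu> q f) \<G>"
      by (intro evG[OF eventually_mono[OF ev]])
    then show "0 \<le> M f" by (rule tendsto_lowerbound[OF lim _ \<G>])
  next
    have "?bdd (\<lambda>_. 1)" unfolding bounded_iff by (rule exI[of _ 1]) simp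
    then have "eventually (\<lambda>q. \<mu> q (\<lambda>_. 1) = 1) \<G>"
      by (intro evG[OF eventually_mono[OF ev]]) (use psum in \<open>simp add: \<mu>_def\<close>)
    then have "((\<lambda>q. \<mu> q (\<lambda>_. 1)) \<longlongrightarrow> 1) \<G>" by (rule tendsto_eventually)
    then show "M (\<lambda>_. 1) = 1" using tendsto_unique[OF \<G> lim] by blast
  next
    fix f :: "'g \<Rightarrow> real" and g
    assume g: "g \<in> carrier G" and f: "?bdd f"
    let ?f = "\<lambda>x. f (inv g \<otimes> x)"
    have f': "?bdd ?f" by (rule bounded_subset[OF f]) (use g in auto)
    have diff: "\<bar>\<mu> q ?f - \<mu> q f\<bar> \<le> b f * (1 / Suc (snd q))" if q: "?valid q" "g \<in> fst q" for q
    proof -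
      note Aq = Afin[OF q(1)] Asub[OF q(1)]
      let ?W = "A q \<union> (\<lambda>y. inv g \<otimes> y) ` A q"
      have W: "finite ?W" "?W \<subseteq> carrier G" using Aq g by auto
      have "(\<Sum>x\<in>A q. ?f x * p q x) = (\<Sum>x\<in>?W. ?f (g \<otimes> x) * p q (g \<otimes> x))"
        by (rule sum_translate[OF \<open>group G\<close> g, symmetric]) (use Aq W psupp[OF q(1)] in auto)
      also have "\<dots> = (\<Sum>x\<in>?W. f x * p q (g \<otimes> x))"
        using W g by (intro sum.cong refl) (auto simp: m_assoc[symmetric])
      finally have 1: "\<mu> q ?f = (\<Sum>x\<in>?W. f x * p q (g \<otimes> x))" using f' by (simp add: \<mu>_def)
      have "(\<Sum>x\<in>A q. f x * p q x) = (\<Sum>x\<in>?W. f x * p q x)"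
        by (rule sum.mono_neutral_left) (use W psupp[OF q(1)] in auto)
      then have 2: "\<mu> q ?f - \<mu> q f = (\<Sum>x\<in>?W. f x * (p q (g \<otimes> x) - p q x))"
        using f 1 by (simp add: \<mu>_def sum_subtractf right_diff_distrib)
      have "\<bar>\<mu> q ?f - \<mu> q f\<bar> \<le> (\<Sum>x\<in>?W. \<bar>f x * (p q (g \<otimes> x) - p q x)\<bar>)"
        unfolding 2 by (rule sum_abs)
      also have "\<dots> \<le> (\<Sum>x\<in>?W. b f * \<bar>p q (g \<otimes> x) - p q x\<bar>)"
      proof (rule sum_mono)
        fix x assume "x \<in> ?W"
        from b[OF f subsetD[OF W(2) this]]
        show "\<bar>f x * (p q (g \<otimes> x) - p q x)\<bar> \<le> b f * \<bar>p q (g \<otimes> x) - p q x\<bar>"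
          by (subst abs_mult) (rule mult_right_mono[OF _ abs_ge_zero])
      qed
      also have "\<dots> = b f * (\<Sum>x\<in>?W. \<bar>p q (g \<otimes> x) - p q x\<bar>)"
        by (rule sum_distrib_left[symmetric])
      also have "\<dots> \<le> b f * (1 / Suc (snd q))"
        by (rule mult_left_mono[OF pinv[OF q] b0])
      finally show ?thesis .
    qed
    have "(\<lambda>k. 1 / real (Suc k)) \<longlonglongrightarrow> 0"
      using LIMSEQ_inverse_real_of_nat by (simp only: inverse_eq_divide)
    then have "((\<lambda>q. 1 / real (Suc (snd q))) \<longlongrightarrow> 0) \<F>"
      unfolding \<F>_def by (rule filterlim_compose[OF _ filterlim_snd])
    then have "((\<lambda>q. b f * (1 / Suc (snd q))) \<longlongrightarrow> b f * 0) \<F>"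
      by (rule tendsto_mult_left)
    then have 0: "((\<lambda>q. b f * (1 / Suc (snd q))) \<longlongrightarrow> 0) \<G>"
      unfolding \<G>_def mult_zero_right by (rule tendsto_mono[OF inf_le2])
    have "((\<lambda>q. \<mu> q ?f - \<mu> q f) \<longlongrightarrow> 0) \<G>"
      by (rule Lim_null_comparison[OF evG[OF eventually_mono[OF ev_S[OF g]]] 0]) (use diff in auto)
    moreover have "((\<lambda>q. \<mu> q ?f - \<mu> q f) \<longlongrightarrow> M ?f - M f) \<G>"
      by (intro tendsto_diff lim)
    ultimately have "M ?f - M f = 0" using tendsto_unique[OF \<G>] by blast
    then show "M ?f = M f" by simp
  qed
qed

text \<open>
  A nonnegative \<open>\<ell>\<^sup>2\<close> vector that all elements of \<open>S\<close> move only a little has a square that is nearly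
  invariant in \<open>\<ell>\<^sup>1\<close>, and such densities for all \<open>S\<close> and \<open>\<epsilon>\<close> would give an invariant mean.
\<close>
lemma spectral_gap:
  fixes G :: "('g, 'b) monoid_scheme" (structure)
  assumes "group G" "\<not> amenable G"
  obtains S \<eta> where "finite S" "S \<subseteq> carrier G" "0 < \<eta>" "\<eta> \<le> 1"
    "\<And>B h. finite B \<Longrightarrow> B \<subseteq> carrier G \<Longrightarrow> (\<And>x. 0 \<le> h x) \<Longrightarrow> (\<And>x. x \<notin> B \<Longrightarrow> h x = (0::real)) \<Longrightarrow>
      0 < L2_set h B \<Longrightarrow>
      \<exists>s\<in>S. \<eta> * L2_set h B \<le> L2_set (\<lambda>x. h (s \<otimes> x) - h x) (B \<union> (\<lambda>y. inv s \<otimes> y) ` B)"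
proof -
  interpret group G by fact
  let ?prob = "\<lambda>A p. finite A \<and> A \<subseteq> carrier G \<and> (\<forall>x. 0 \<le> p x) \<and> (\<forall>x. x \<notin> A \<longrightarrow> p x = 0) \<and> sum p A = (1::real)"
  let ?dist = "\<lambda>A p s. \<Sum>x\<in>A \<union> (\<lambda>y. inv s \<otimes> y) ` A. \<bar>p (s \<otimes> x) - p x :: real\<bar>"
  have "\<not> (\<forall>S \<epsilon>. finite S \<longrightarrow> S \<subseteq> carrier G \<longrightarrow> 0 < \<epsilon> \<longrightarrow> (\<exists>A p. ?prob A p \<and> (\<forall>s\<in>S. ?dist A p s \<le> \<epsilon>)))"
  proof
    assume *: "\<forall>S \<epsilon>. finite S \<longrightarrow> S \<subseteq> carrier G \<longrightarrow> 0 < \<epsilon> \<longrightarrow> (\<exists>A p. ?prob A p \<and> (\<forall>s\<in>S. ?dist A p s \<le> \<epsilon>))"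
    have "amenable G"
    proof (rule amenable_of_reiter[OF \<open>group G\<close>])
      fix S and \<epsilon> :: real
      assume "finite S" "S \<subseteq> carrier G" "0 < \<epsilon>"
      from *[rule_format, OF this] obtain A p where "?prob A p \<and> (\<forall>s\<in>S. ?dist A p s \<le> \<epsilon>)" by blast
      then show "\<exists>A p. finite A \<and> A \<subseteq> carrier G \<and> (\<forall>x. 0 \<le> p x) \<and> (\<forall>x. x \<notin> A \<longrightarrow> p x = 0) \<and> sum p A = (1::real) \<and>
        (\<forall>s\<in>S. (\<Sum>x\<in>A \<union> (\<lambda>y. inv s \<otimes> y) ` A. \<bar>p (s \<otimes> x) - p x\<bar>) \<le> \<epsilon>)"
        by (elim conjE, intro exI[of _ A] exI[of _ p] conjI) assumption+
    qed
    then show False using \<open>\<not> amenable G\<close> by simp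
  qed
  then obtain S \<epsilon> where S: "finite S" "S \<subseteq> carrier G" "0 < \<epsilon>"
    and not: "\<not> (\<exists>A p. ?prob A p \<and> (\<forall>s\<in>S. ?dist A p s \<le> \<epsilon>))"
    by (simp only: not_all not_imp) blast
  have no: "\<exists>s\<in>S. \<epsilon> < ?dist A p s" if "?prob A p" for A p
  proof (rule ccontr)
    assume "\<not> (\<exists>s\<in>S. \<epsilon> < ?dist A p s)"
    then have "\<forall>s\<in>S. ?dist A p s \<le> \<epsilon>" by (simp only: bex_simps not_less)
    then show False using not that by blast
  qed
  \<comment> \<open>Capping at 1 keeps \<open>4 - \<eta>\<^sup>2\<close> positive where the gap is used.\<close>
  define \<eta> where "\<eta> = min 1 (\<epsilon> / 2)"
  have "\<exists>s\<in>S. \<eta> * L2_set h B \<le> L2_set (\<lambda>x. h (s \<otimes> x) - h x) (B \<union> (\<lambda>y. inv s \<otimes> y) ` B)"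
    if B: "finite B" "B \<subseteq> carrier G" and h: "\<And>x. 0 \<le> h x" "\<And>x. x \<notin> B \<Longrightarrow> h x = (0::real)"
      and pos: "0 < L2_set h B" for B h
  proof -
    define N where "N = L2_set h B"
    define p where "p x = (h x)\<^sup>2 / N\<^sup>2" for x
    have N: "0 < N" using pos by (simp add: N_def)
    have "sum p B = 1"
      using N by (simp add: p_def sum_divide_distrib[symmetric] L2_set_power2[symmetric] N_def)
    then obtain s where s: "s \<in> S" and gt: "\<epsilon> < (\<Sum>x\<in>B \<union> (\<lambda>y. inv s \<otimes> y) ` B. \<bar>p (s \<otimes> x) - p x\<bar>)"
      using no[of B p] B h by (auto simp: p_def)
    let ?W = "B \<union> (\<lambda>y. inv s \<otimes> y) ` B"
    have sc: "s \<in> carrier G" using s S by auto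
    have W: "finite ?W" "?W \<subseteq> carrier G" using B sc by auto
    have L1: "L2_set (\<lambda>x. h (s \<otimes> x)) ?W = N"
      using sum_translate[OF \<open>group G\<close> sc B(2), of "\<lambda>x. (h x)\<^sup>2" ?W] W h(2)
      by (simp add: L2_set_def N_def)
    have L2: "L2_set h ?W = N"
      unfolding N_def L2_set_def using W h(2) by (subst sum.mono_neutral_left[of ?W B]) auto
    have "\<epsilon> < (\<Sum>x\<in>?W. \<bar>(h (s \<otimes> x))\<^sup>2 - (h x)\<^sup>2\<bar>) / N\<^sup>2"
      using gt by (simp add: p_def diff_divide_distrib[symmetric] abs_divide sum_divide_distrib[symmetric])
    also have "\<dots> \<le> L2_set (\<lambda>x. h (s \<otimes> x) - h x) ?W * (N + N) / N\<^sup>2"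
      using L2_set_square_diff[of "\<lambda>x. h (s \<otimes> x)" h ?W] by (simp add: L1 L2 divide_right_mono)
    finally have "\<epsilon> * N < 2 * L2_set (\<lambda>x. h (s \<otimes> x) - h x) ?W"
      using N by (simp add: field_simps power2_eq_square)
    moreover have "\<eta> * N \<le> \<epsilon> / 2 * N" using N by (intro mult_right_mono) (auto simp: \<eta>_def)
    ultimately show ?thesis using s by (intro bexI[of _ s]) (auto simp: N_def)
  qed
  then show ?thesis using S by (intro that[of S \<eta>]) (auto simp: \<eta>_def)
qed

text \<open>
  With the identity in \<open>S\<close>, the parallelogram law turns the displacement of \<open>h\<close> by some \<open>s \<in> S\<close> into a gain
  in \<open>\<parallel>h + h(s\<cdot>)\<parallel> \<le> \<surd>(4 - \<eta>\<^sup>2) \<parallel>h\<parallel>\<close>; the other summands are bounded by the triangle inequality.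
  The element \<open>s\<close> depends on \<open>h\<close>, but the gain does not.
\<close>
lemma kesten:
  fixes G :: "('g, 'b) monoid_scheme" (structure)
  assumes "group G" "\<not> amenable G"
  obtains S and r :: real where "finite S" "S \<subseteq> carrier G" "\<one> \<in> S" "0 < r" "r < 1"
    "\<And>A B h. finite A \<Longrightarrow> A \<subseteq> carrier G \<Longrightarrow> finite B \<Longrightarrow> B \<subseteq> carrier G \<Longrightarrow>
      (\<And>x. 0 \<le> h x) \<Longrightarrow> (\<And>x. x \<notin> B \<Longrightarrow> h x = 0) \<Longrightarrow>
      L2_set (\<lambda>x. \<Sum>s\<in>S. h (s \<otimes> x)) A \<le> r * card S * L2_set h B"
proof -
  interpret group G by fact
  obtain S0 \<eta> where S0: "finite S0" "S0 \<subseteq> carrier G" and \<eta>: "0 < \<eta>" "\<eta> \<le> 1"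
    and gap: "\<And>B h. finite B \<Longrightarrow> B \<subseteq> carrier G \<Longrightarrow> (\<And>x. 0 \<le> h x) \<Longrightarrow> (\<And>x. x \<notin> B \<Longrightarrow> h x = (0::real)) \<Longrightarrow>
      0 < L2_set h B \<Longrightarrow>
      \<exists>s\<in>S0. \<eta> * L2_set h B \<le> L2_set (\<lambda>x. h (s \<otimes> x) - h x) (B \<union> (\<lambda>y. inv s \<otimes> y) ` B)"
    by (rule spectral_gap[OF assms], rule that, assumption+, blast)
  define S where "S = insert \<one> S0"
  \<comment> \<open>The maximum only ensures that \<open>r\<close> is positive.\<close>
  define r where "r = max (1 / 2) (1 - (2 - sqrt (4 - \<eta>\<^sup>2)) / card S)"
  have S: "finite S" "S \<subseteq> carrier G" "\<one> \<in> S" using S0 by (auto simp: S_def)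
  have cS: "0 < card S" using S by (auto simp: card_gt_0_iff)
  have "sqrt (4 - \<eta>\<^sup>2) < 2" using \<eta> by (intro real_less_lsqrt) auto
  then have r: "0 < r" "r < 1" using cS by (auto simp: r_def)
  have "L2_set (\<lambda>x. \<Sum>s\<in>S. h (s \<otimes> x)) A \<le> r * card S * L2_set h B"
    if A: "finite A" "A \<subseteq> carrier G" and B: "finite B" "B \<subseteq> carrier G"
      and h: "\<And>x. 0 \<le> h x" "\<And>x. x \<notin> B \<Longrightarrow> h x = 0" for A B and h :: "'g \<Rightarrow> real"
  proof -
    define N where "N = L2_set h B"
    define W where "W = A \<union> B \<union> (\<Union>s\<in>S. (\<lambda>y. inv s \<otimes> y) ` B)"
    have W: "finite W" "W \<subseteq> carrier G" using A B S by (auto simp: W_def intro!: m_closed inv_closed)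
    have L: "L2_set (\<lambda>x. h (s \<otimes> x)) W = N" if "s \<in> S" for s
      using sum_translate[OF \<open>group G\<close> _ B(2), of s "\<lambda>x. (h x)\<^sup>2" W] that S W h(2)
      by (auto simp: L2_set_def N_def W_def)
    have "L2_set (\<lambda>x. \<Sum>s\<in>S. h (s \<otimes> x)) A \<le> L2_set (\<lambda>x. \<Sum>s\<in>S. h (s \<otimes> x)) W"
      unfolding L2_set_def by (intro real_sqrt_le_mono sum_mono2) (use W in \<open>auto simp: W_def\<close>)
    also have "\<dots> \<le> r * card S * N"
    proof (cases "N = 0")
      case True
      have "L2_set (\<lambda>x. \<Sum>s\<in>S. h (s \<otimes> x)) W \<le> (\<Sum>s\<in>S. L2_set (\<lambda>x. h (s \<otimes> x)) W)"
        by (rule L2_set_sum_le)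
      then show ?thesis using L True by simp
    next
      case False
      then have N: "0 < N" by (simp add: N_def less_le)
      obtain s where s: "s \<in> S0"
        and diff: "\<eta> * N \<le> L2_set (\<lambda>x. h (s \<otimes> x) - h x) (B \<union> (\<lambda>y. inv s \<otimes> y) ` B)"
        using gap[of B h, OF B h] N by (auto simp: N_def)
      have sS: "s \<in> S" using s by (simp add: S_def)
      have "L2_set (\<lambda>x. h (s \<otimes> x) - h x) (B \<union> (\<lambda>y. inv s \<otimes> y) ` B)
          \<le> L2_set (\<lambda>x. h (s \<otimes> x) - h x) W"
        unfolding L2_set_def by (intro real_sqrt_le_mono sum_mono2) (use W sS in \<open>auto simp: W_def\<close>)
      then have diffW: "\<eta> * N \<le> L2_set (\<lambda>x. h (s \<otimes> x) - h x) W" using diff by simp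
      \<comment> \<open>The two terms that are paired in the parallelogram law must be different elements of \<open>S\<close>.\<close>
      have s1: "s \<noteq> \<one>"
      proof
        assume "s = \<one>"
        then have "L2_set (\<lambda>x. h (s \<otimes> x) - h x) W = 0"
          using W by (intro L2_set_0') auto
        then show False using diffW \<eta> N by (simp add: mult_le_0_iff)
      qed
      have h1: "L2_set h W = N"
        using L[OF S(3)] W by (auto simp: L2_set_def subset_iff cong: sum.cong)
      have "(L2_set (\<lambda>x. h x + h (s \<otimes> x)) W)\<^sup>2 + (L2_set (\<lambda>x. h (s \<otimes> x) - h x) W)\<^sup>2
          = 2 * (L2_set h W)\<^sup>2 + 2 * (L2_set (\<lambda>x. h (s \<otimes> x)) W)\<^sup>2"
        unfolding L2_set_power2 sum.distrib[symmetric] sum_distrib_left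
        by (intro sum.cong refl) (simp add: power2_eq_square algebra_simps)
      moreover have "(\<eta> * N)\<^sup>2 \<le> (L2_set (\<lambda>x. h (s \<otimes> x) - h x) W)\<^sup>2"
        using diffW \<eta> N by (intro power_mono) auto
      ultimately have "(L2_set (\<lambda>x. h x + h (s \<otimes> x)) W)\<^sup>2 \<le> (4 - \<eta>\<^sup>2) * N\<^sup>2"
        using h1 L[OF sS] by (simp add: power_mult_distrib algebra_simps)
      then have "L2_set (\<lambda>x. h x + h (s \<otimes> x)) W \<le> sqrt ((4 - \<eta>\<^sup>2) * N\<^sup>2)"
        by (rule real_le_rsqrt)
      then have two: "L2_set (\<lambda>x. h x + h (s \<otimes> x)) W \<le> sqrt (4 - \<eta>\<^sup>2) * N"
        using N by (simp add: real_sqrt_mult)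
      have "(\<Sum>t\<in>S. h (t \<otimes> x)) = (h x + h (s \<otimes> x)) + (\<Sum>t\<in>S - {\<one>, s}. h (t \<otimes> x))" if "x \<in> W" for x
      proof -
        have "x \<in> carrier G" using that W by auto
        moreover have "(\<Sum>t\<in>S. h (t \<otimes> x)) = (\<Sum>t\<in>{\<one>, s}. h (t \<otimes> x)) + (\<Sum>t\<in>S - {\<one>, s}. h (t \<otimes> x))"
          using S sS by (subst sum.subset_diff[of "{\<one>, s}" S]) auto
        ultimately show ?thesis using s1 by simp
      qed
      then have "L2_set (\<lambda>x. \<Sum>t\<in>S. h (t \<otimes> x)) W
          = L2_set (\<lambda>x. (h x + h (s \<otimes> x)) + (\<Sum>t\<in>S - {\<one>, s}. h (t \<otimes> x))) W"
        by (intro L2_set_cong) auto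
      also have "\<dots> \<le> L2_set (\<lambda>x. h x + h (s \<otimes> x)) W + L2_set (\<lambda>x. \<Sum>t\<in>S - {\<one>, s}. h (t \<otimes> x)) W"
        by (rule L2_set_triangle_ineq)
      also have "\<dots> \<le> sqrt (4 - \<eta>\<^sup>2) * N + (\<Sum>t\<in>S - {\<one>, s}. L2_set (\<lambda>x. h (t \<otimes> x)) W)"
        by (intro add_mono two L2_set_sum_le)
      also have "(\<Sum>t\<in>S - {\<one>, s}. L2_set (\<lambda>x. h (t \<otimes> x)) W) = card (S - {\<one>, s}) * N"
        using L by simp
      also have "real (card (S - {\<one>, s})) = real (card S) - 2"
      proof -
        have "card {\<one>, s} \<le> card S" using S sS by (intro card_mono) auto
        then show ?thesis using S sS s1 by (subst card_Diff_subset) auto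
      qed
      also have "sqrt (4 - \<eta>\<^sup>2) * N + (real (card S) - 2) * N = (1 - (2 - sqrt (4 - \<eta>\<^sup>2)) / card S) * card S * N"
        using cS by (simp add: field_simps)
      also have "\<dots> \<le> r * card S * N"
        using N by (intro mult_right_mono) (auto simp: r_def)
      finally show ?thesis .
    qed
    finally show ?thesis by (simp add: N_def)
  qed
  then show ?thesis using S r by (intro that[of S r]) auto
qed

section \<open>Large sets of small convolution norm\<close>

text \<open>
  The \<open>k\<close>-fold convolution power of the indicator function of \<open>S\<close>: it counts the ways to write \<open>x\<close> as
  a product of \<open>k\<close> elements of \<open>S\<close>.
\<close>
primrec steps :: "('g, 'b) monoid_scheme \<Rightarrow> 'g set \<Rightarrow> nat \<Rightarrow> 'g \<Rightarrow> nat" where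
  "steps G S 0 x = of_bool (x = \<one>\<^bsub>G\<^esub>)"
| "steps G S (Suc k) x = (\<Sum>s\<in>S. steps G S k (inv\<^bsub>G\<^esub> s \<otimes>\<^bsub>G\<^esub> x))"

primrec reach :: "('g, 'b) monoid_scheme \<Rightarrow> 'g set \<Rightarrow> nat \<Rightarrow> 'g set" where
  "reach G S 0 = {\<one>\<^bsub>G\<^esub>}"
| "reach G S (Suc k) = (\<Union>s\<in>S. (\<lambda>y. s \<otimes>\<^bsub>G\<^esub> y) ` reach G S k)"

lemma reach_finite_carrier:
  assumes "group G" "finite S" "S \<subseteq> carrier G"
  shows "finite (reach G S k)" "reach G S k \<subseteq> carrier G"
proof -
  interpret group G by fact
  show "finite (reach G S k)" using assms by (induction k) auto
  show "reach G S k \<subseteq> carrier G" using assms by (induction k) (auto intro!: m_closed)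
qed

lemma steps_off_reach:
  fixes G (structure)
  assumes "group G" and S: "S \<subseteq> carrier G"
  shows "x \<in> carrier G \<Longrightarrow> x \<notin> reach G S k \<Longrightarrow> steps G S k x = 0"
proof (induction k arbitrary: x)
  case (Suc k)
  interpret group G by fact
  have "steps G S k (inv s \<otimes> x) = 0" if s: "s \<in> S" for s
  proof (rule Suc.IH)
    have sc: "s \<in> carrier G" using s S by auto
    then show "inv s \<otimes> x \<in> carrier G" using Suc.prems by simp
    have "s \<otimes> (inv s \<otimes> x) = x" using sc Suc.prems by (simp add: m_assoc[symmetric])
    then show "inv s \<otimes> x \<notin> reach G S k"
      using Suc.prems s by (metis UN_I imageI reach.simps(2))
  qed
  then show ?case by simp
qed simp

lemma sum_steps:
  fixes G (structure)
  assumes "group G" and S: "finite S" "S \<subseteq> carrier G"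
  shows "(\<Sum>x\<in>reach G S k. steps G S k x) = card S ^ k"
proof (induction k)
  case (Suc k)
  interpret group G by fact
  have "(\<Sum>x\<in>reach G S (Suc k). steps G S (Suc k) x)
      = (\<Sum>s\<in>S. \<Sum>x\<in>reach G S (Suc k). steps G S k (inv s \<otimes> x))"
    unfolding steps.simps by (rule sum.swap)
  also have "\<dots> = (\<Sum>s\<in>S. card S ^ k)"
  proof (rule sum.cong[OF refl])
    fix s assume s: "s \<in> S"
    then have sc: "s \<in> carrier G" using S by auto
    have "(\<Sum>x\<in>reach G S (Suc k). steps G S k (inv s \<otimes> x)) = (\<Sum>y\<in>reach G S k. steps G S k y)"
    proof (rule sum_translate[OF \<open>group G\<close>])
      show "(\<lambda>y. inv (inv s) \<otimes> y) ` reach G S k \<subseteq> reach G S (Suc k)" using s sc by auto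
    qed (use sc steps_off_reach[OF \<open>group G\<close> S(2)] reach_finite_carrier[OF \<open>group G\<close> S, of "Suc k"]
        reach_finite_carrier[OF \<open>group G\<close> S, of k] in \<open>simp_all del: reach.simps\<close>)
    then show "(\<Sum>x\<in>reach G S (Suc k). steps G S k (inv s \<otimes> x)) = card S ^ k"
      using Suc.IH by simp
  qed
  finally show ?case by simp
qed simp

text \<open>
  Convolution by the \<open>k\<close>-step counts is the \<open>k\<close>-th power of the operator that is bounded by \<open>R\<close>. One factor
  at a time is moved to the test function \<open>h\<close>.
\<close>
lemma kernel_bound_steps:
  fixes G :: "('g, 'b) monoid_scheme" (structure)
  assumes "group G" and S: "finite S" "S \<subseteq> carrier G" and R: "0 \<le> R"
    and contr: "\<And>A B h. finite A \<Longrightarrow> A \<subseteq> carrier G \<Longrightarrow> finite B \<Longrightarrow> B \<subseteq> carrier G \<Longrightarrow>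
      (\<And>x. 0 \<le> h x) \<Longrightarrow> (\<And>x. x \<notin> B \<Longrightarrow> h x = 0) \<Longrightarrow>
      L2_set (\<lambda>x. \<Sum>s\<in>S. h (s \<otimes> x)) A \<le> R * L2_set h B"
  shows "kernel_bound G (\<lambda>x. real (steps G S k x)) (R ^ k)"
proof (induction k)
  case 0
  interpret group G by fact
  show ?case
    unfolding kernel_bound_def
  proof (intro allI impI)
    fix A B and f h :: "'g \<Rightarrow> real"
    assume A: "finite A" "A \<subseteq> carrier G" and B: "finite B" "B \<subseteq> carrier G"
      and nn: "\<forall>x. 0 \<le> f x" "\<forall>x. 0 \<le> h x"
    have eq1: "y \<otimes> inv x = \<one> \<longleftrightarrow> x = y" if "x \<in> A" "y \<in> B" for x y
      using that A B by (metis inv_closed inv_equality inv_inv r_inv subsetD)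
    have "(\<Sum>x\<in>A. \<Sum>y\<in>B. real (steps G S 0 (y \<otimes> inv x)) * f x * h y)
        = (\<Sum>x\<in>A. \<Sum>y\<in>B. if x = y then f x * h y else 0)"
      by (intro sum.cong refl) (simp add: eq1)
    also have "\<dots> = (\<Sum>x\<in>A \<inter> B. \<bar>f x\<bar> * \<bar>h x\<bar>)"
      using A B nn by (simp add: sum.delta sum.inter_restrict cong: sum.cong)
    also have "\<dots> \<le> L2_set f (A \<inter> B) * L2_set h (A \<inter> B)" by (rule L2_set_mult_ineq)
    also have "\<dots> \<le> L2_set f A * L2_set h B"
      unfolding L2_set_def
      by (intro mult_mono real_sqrt_le_mono sum_mono2) (use A B in \<open>auto simp: sum_nonneg\<close>)
    finally show "(\<Sum>x\<in>A. \<Sum>y\<in>B. real (steps G S 0 (y \<otimes> inv x)) * f x * h y)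
        \<le> R ^ 0 * L2_set f A * L2_set h B" by simp
  qed
next
  case (Suc k)
  interpret group G by fact
  show ?case
    unfolding kernel_bound_def
  proof (intro allI impI)
    fix A B and f h :: "'g \<Rightarrow> real"
    assume A: "finite A" "A \<subseteq> carrier G" and B: "finite B" "B \<subseteq> carrier G"
      and nn: "\<forall>x. 0 \<le> f x" "\<forall>x. 0 \<le> h x"
    define h0 where "h0 x = (if x \<in> B then h x else 0)" for x
    define h1 where "h1 z = (\<Sum>s\<in>S. h0 (s \<otimes> z))" for z
    define Z where "Z = (\<Union>s\<in>S. (\<lambda>y. inv s \<otimes> y) ` B)"
    have Z: "finite Z" "Z \<subseteq> carrier G"
      using S B by (auto simp: Z_def intro!: m_closed inv_closed)
    let ?w = "\<lambda>x. real (steps G S k x)"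
    have inner: "(\<Sum>y\<in>B. ?w (inv s \<otimes> (y \<otimes> inv x)) * h y) = (\<Sum>z\<in>Z. ?w (z \<otimes> inv x) * h0 (s \<otimes> z))"
      if "s \<in> S" "x \<in> A" for s x
    proof -
      have sc: "s \<in> carrier G" and xc: "x \<in> carrier G" using that S A by auto
      have "(\<Sum>y\<in>B. ?w (inv s \<otimes> (y \<otimes> inv x)) * h y) = (\<Sum>y\<in>B. ?w (inv s \<otimes> (y \<otimes> inv x)) * h0 y)"
        by (simp add: h0_def)
      also have "\<dots> = (\<Sum>z\<in>Z. ?w (inv s \<otimes> ((s \<otimes> z) \<otimes> inv x)) * h0 (s \<otimes> z))"
        by (rule sum_translate[OF \<open>group G\<close> sc B(2), symmetric])
          (use Z that in \<open>auto simp: h0_def Z_def\<close>)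
      also have "\<dots> = (\<Sum>z\<in>Z. ?w (z \<otimes> inv x) * h0 (s \<otimes> z))"
      proof (rule sum.cong[OF refl])
        fix z assume "z \<in> Z"
        then have zc: "z \<in> carrier G" using Z by auto
        have "inv s \<otimes> ((s \<otimes> z) \<otimes> inv x) = (inv s \<otimes> s) \<otimes> (z \<otimes> inv x)"
          using sc zc xc by (simp only: m_assoc m_closed inv_closed)
        also have "\<dots> = z \<otimes> inv x" using sc zc xc by simp
        finally show "?w (inv s \<otimes> ((s \<otimes> z) \<otimes> inv x)) * h0 (s \<otimes> z) = ?w (z \<otimes> inv x) * h0 (s \<otimes> z)"
          by simp
      qed
      finally show ?thesis .
    qed
    have "(\<Sum>x\<in>A. \<Sum>y\<in>B. real (steps G S (Suc k) (y \<otimes> inv x)) * f x * h y)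
        = (\<Sum>x\<in>A. f x * (\<Sum>y\<in>B. \<Sum>s\<in>S. ?w (inv s \<otimes> (y \<otimes> inv x)) * h y))"
      by (simp add: sum_distrib_left sum_distrib_right mult.assoc mult.left_commute)
    also have "\<dots> = (\<Sum>x\<in>A. f x * (\<Sum>s\<in>S. \<Sum>y\<in>B. ?w (inv s \<otimes> (y \<otimes> inv x)) * h y))"
      by (subst sum.swap) (rule refl)
    also have "\<dots> = (\<Sum>x\<in>A. f x * (\<Sum>s\<in>S. \<Sum>z\<in>Z. ?w (z \<otimes> inv x) * h0 (s \<otimes> z)))"
      by (simp add: inner)
    also have "\<dots> = (\<Sum>x\<in>A. f x * (\<Sum>z\<in>Z. \<Sum>s\<in>S. ?w (z \<otimes> inv x) * h0 (s \<otimes> z)))"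
      by (subst sum.swap) (rule refl)
    also have "\<dots> = (\<Sum>x\<in>A. \<Sum>z\<in>Z. ?w (z \<otimes> inv x) * f x * h1 z)"
      by (simp add: h1_def sum_distrib_left mult.assoc mult.left_commute)
    also have "\<dots> \<le> R ^ k * L2_set f A * L2_set h1 Z"
    proof (rule Suc.IH[unfolded kernel_bound_def, rule_format, OF A Z])
      show "0 \<le> h1 z" for z using nn by (simp add: h1_def h0_def sum_nonneg)
    qed (use nn in simp)
    also have "\<dots> \<le> R ^ k * L2_set f A * (R * L2_set h0 B)"
      unfolding h1_def
      by (intro mult_left_mono contr[OF Z B]) (use nn R in \<open>auto simp: h0_def\<close>)
    also have "L2_set h0 B = L2_set h B"
      by (rule L2_set_cong) (auto simp: h0_def)
    finally show "(\<Sum>x\<in>A. \<Sum>y\<in>B. real (steps G S (Suc k) (y \<otimes> inv x)) * f x * h y)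
        \<le> R ^ Suc k * L2_set f A * L2_set h B" by (simp add: ac_simps)
  qed
qed

lemma kernel_bound_mono:
  fixes G :: "('g, 'b) monoid_scheme"
  assumes kb: "kernel_bound G w C" and d: "0 < d" and le: "\<And>x. d * v x \<le> w x" and C: "C / d \<le> C'"
  shows "kernel_bound G v C'"
  unfolding kernel_bound_def
proof (intro allI impI)
  fix A B and f h :: "'g \<Rightarrow> real"
  assume A: "finite A" "A \<subseteq> carrier G" and B: "finite B" "B \<subseteq> carrier G"
    and nn: "\<forall>x. 0 \<le> f x" "\<forall>x. 0 \<le> h x"
  let ?z = "\<lambda>x y. y \<otimes>\<^bsub>G\<^esub> inv\<^bsub>G\<^esub> x"
  have "d * (\<Sum>x\<in>A. \<Sum>y\<in>B. v (?z x y) * f x * h y) = (\<Sum>x\<in>A. \<Sum>y\<in>B. (d * v (?z x y)) * f x * h y)"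
    by (simp add: sum_distrib_left mult.assoc)
  also have "\<dots> \<le> (\<Sum>x\<in>A. \<Sum>y\<in>B. w (?z x y) * f x * h y)"
    using nn by (intro sum_mono mult_right_mono le) auto
  also have "\<dots> \<le> C * L2_set f A * L2_set h B"
    using kb A B nn by (simp add: kernel_bound_def)
  finally have "(\<Sum>x\<in>A. \<Sum>y\<in>B. v (?z x y) * f x * h y) \<le> C / d * (L2_set f A * L2_set h B)"
    using d by (simp add: field_simps)
  also have "\<dots> \<le> C' * (L2_set f A * L2_set h B)"
    by (intro mult_right_mono C) simp
  finally show "(\<Sum>x\<in>A. \<Sum>y\<in>B. v (?z x y) * f x * h y) \<le> C' * L2_set f A * L2_set h B"
    by (simp add: mult.assoc)
qed

text \<open>
  Convolution by the indicator function of a nonempty set has a matrix entry equal to 1.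
\<close>
lemma kernel_bound_ge_one:
  assumes "group G" "F \<subseteq> carrier G" "t \<in> F" and kb: "kernel_bound G (\<lambda>x. of_bool (x \<in> F)) C"
  shows "1 \<le> C"
proof -
  interpret group G by fact
  have "t \<in> carrier G" using assms by auto
  then show ?thesis
    using kb[unfolded kernel_bound_def, rule_format, of "{\<one>\<^bsub>G\<^esub>}" "{t}" "\<lambda>_. 1" "\<lambda>_. 1"] \<open>t \<in> F\<close>
    by simp
qed

text \<open>
  The \<open>k\<close>-step counts have total mass \<open>|S|\<^sup>k\<close> and values at most \<open>2\<^bsup>|S|k\<^esup>\<close>, so one of their \<open>|S|k + 1\<close>
  dyadic level sets \<open>F\<close> carries a proportional part of the mass. The factor 2 is the variation of the counts
  within a dyadic level.
\<close>
lemma level_set: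
  fixes G :: "('g, 'b) monoid_scheme" (structure) and r :: real
  assumes "group G" and S: "finite S" "S \<subseteq> carrier G" "S \<noteq> {}" and r: "0 < r"
    and kb: "kernel_bound G (\<lambda>x. real (steps G S k x)) ((r * card S) ^ k)"
  obtains F where "finite F" "F \<subseteq> carrier G" "F \<noteq> {}" "card F \<le> card S ^ k"
    "kernel_bound G (\<lambda>x. of_bool (x \<in> F)) (2 * (card S * k + 1) * r ^ k * card F)"
proof -
  let ?P = "reach G S k" and ?c = "steps G S k" and ?J = "card S * k"
  note P = reach_finite_carrier[OF \<open>group G\<close> S(1,2), of k]
  note total = sum_steps[OF \<open>group G\<close> S(1,2), of k]
  have cS: "0 < card S" using S by (simp add: card_gt_0_iff)
  define F where "F j = {x \<in> ?P. 2 ^ j \<le> ?c x \<and> ?c x < 2 ^ Suc j}" for j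
  have Ff: "finite (F j)" for j using P by (simp add: F_def)
  have cover: "\<exists>j\<le>?J. x \<in> F j" if x: "x \<in> ?P" "?c x \<noteq> 0" for x
  proof -
    obtain j where j: "2 ^ j \<le> ?c x" "?c x < 2 ^ (j + 1)"
      using ex_power_ivl1[of 2 "?c x"] x by auto
    have "2 ^ j \<le> card S ^ k"
      using j(1) member_le_sum[of x ?P ?c] x P total by simp
    also have "\<dots> \<le> (2 ^ card S) ^ k" by (intro power_mono) (auto intro: less_imp_le)
    finally have "j \<le> ?J" by (simp add: power_mult[symmetric])
    then show ?thesis using j x by (auto simp: F_def)
  qed
  have "card S ^ k = (\<Sum>x\<in>{x\<in>?P. ?c x \<noteq> 0}. ?c x)"
    unfolding total[symmetric] by (rule sum.mono_neutral_right) (use P in auto)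
  also have "\<dots> \<le> (\<Sum>x\<in>{x\<in>?P. ?c x \<noteq> 0}. \<Sum>j\<le>?J. of_bool (x \<in> F j) * ?c x)"
  proof (rule sum_mono)
    fix x assume "x \<in> {x\<in>?P. ?c x \<noteq> 0}"
    then obtain j where "j \<le> ?J" "x \<in> F j" using cover by blast
    then show "?c x \<le> (\<Sum>j\<le>?J. of_bool (x \<in> F j) * ?c x)"
      using member_le_sum[of j "{..?J}" "\<lambda>j. of_bool (x \<in> F j) * ?c x"] by simp
  qed
  also have "\<dots> = (\<Sum>j\<le>?J. \<Sum>x\<in>{x\<in>?P. ?c x \<noteq> 0}. of_bool (x \<in> F j) * ?c x)"
    by (rule sum.swap)
  also have "\<dots> = (\<Sum>j\<le>?J. \<Sum>x\<in>F j. ?c x)"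
    by (intro sum.cong refl sum.mono_neutral_cong_right) (use P in \<open>auto simp: F_def\<close>)
  also have "\<dots> \<le> (\<Sum>j\<le>?J. 2 ^ Suc j * card (F j))"
  proof (rule sum_mono)
    fix j
    have "(\<Sum>x\<in>F j. ?c x) \<le> (\<Sum>x\<in>F j. 2 ^ Suc j)" by (rule sum_mono) (simp add: F_def)
    then show "(\<Sum>x\<in>F j. ?c x) \<le> 2 ^ Suc j * card (F j)" by (simp add: mult.commute)
  qed
  finally have le: "card S ^ k \<le> (\<Sum>j\<le>?J. 2 ^ Suc j * card (F j))" .
  obtain j where j: "card S ^ k \<le> (?J + 1) * (2 ^ Suc j * card (F j))"
  proof (rule ccontr)
    assume neg: "\<not> thesis"
    have "(?J + 1) * (\<Sum>j\<le>?J. 2 ^ Suc j * card (F j)) = (\<Sum>j\<le>?J. (?J + 1) * (2 ^ Suc j * card (F j)))"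
      by (rule sum_distrib_left)
    also have "\<dots> < (\<Sum>j\<le>?J. card S ^ k)"
      by (rule sum_strict_mono) (use neg that in \<open>auto simp: not_le[symmetric]\<close>)
    also have "\<dots> = (?J + 1) * card S ^ k" by simp
    finally show False using le by (meson mult_le_mono2 not_le)
  qed
  have ne: "F j \<noteq> {}" using j cS by auto
  have "card (F j) = (\<Sum>x\<in>F j. 1)" by simp
  also have "\<dots> \<le> (\<Sum>x\<in>F j. ?c x)"
  proof (rule sum_mono)
    fix x assume "x \<in> F j"
    then have "2 ^ j \<le> ?c x" by (simp add: F_def)
    then show "1 \<le> ?c x" using one_le_power[of "2::nat" j] by linarith
  qed
  also have "\<dots> \<le> (\<Sum>x\<in>?P. ?c x)" by (rule sum_mono2) (use P in \<open>auto simp: F_def\<close>)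
  finally have card: "card (F j) \<le> card S ^ k" using total by simp
  have "(r * card S) ^ k / 2 ^ j \<le> 2 * (?J + 1) * r ^ k * card (F j)"
  proof -
    have "real (card S ^ k) \<le> real ((?J + 1) * (2 ^ Suc j * card (F j)))"
      using j by (simp only: of_nat_le_iff)
    then have "real (card S) ^ k \<le> real (?J + 1) * (2 ^ Suc j * card (F j))"
      by (simp only: of_nat_mult of_nat_power of_nat_numeral)
    then have "r ^ k * real (card S) ^ k \<le> r ^ k * (real (?J + 1) * (2 ^ Suc j * card (F j)))"
      using r by (intro mult_left_mono) simp_all
    then show ?thesis by (simp add: field_simps power_mult_distrib)
  qed
  then have "kernel_bound G (\<lambda>x. of_bool (x \<in> F j)) (2 * (?J + 1) * r ^ k * card (F j))"
  proof (rule kernel_bound_mono[OF kb, rotated 2])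
    fix x
    have "2 ^ j \<le> ?c x" if "x \<in> F j" using that by (simp add: F_def)
    then show "2 ^ j * of_bool (x \<in> F j) \<le> real (?c x)"
      by (cases "x \<in> F j") (simp_all add: numeral_power_le_of_nat_cancel_iff)
  qed simp
  moreover have "F j \<subseteq> carrier G" using P by (auto simp: F_def)
  ultimately show ?thesis using that Ff ne card by blast
qed

text \<open>
  With \<open>q = \<surd>r\<close>, one factor \<open>q\<^sup>k\<close> of \<open>r\<^sup>k\<close> absorbs the linear factor in \<open>k\<close> that comes from the number of
  levels. The other is a negative power of \<open>|F|\<close>, as \<open>\<theta>\<close> is chosen with
  \<open>q\<^sup>k = (2\<^bsup>|S|k\<^esup>)\<^sup>-\<^sup>\<theta>\<close> and \<open>|F| \<le> |S|\<^sup>k \<le> 2\<^bsup>|S|k\<^esup>\<close>.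
\<close>
lemma small_norm_sets:
  fixes G :: "('g, 'b) monoid_scheme" (structure)
  assumes "group G" "\<not> amenable G"
  obtains \<theta> :: real where "0 < \<theta>"
    "\<And>N. \<exists>F. finite F \<and> F \<subseteq> carrier G \<and> N \<le> card F \<and>
      kernel_bound G (\<lambda>x. of_bool (x \<in> F)) (card F powr (1 - \<theta>))"
proof (rule kesten[OF assms])
  fix S and r :: real
  assume S: "finite S" "S \<subseteq> carrier G" "\<one> \<in> S" and r: "0 < r" "r < 1"
    and contr: "\<And>A B h. finite A \<Longrightarrow> A \<subseteq> carrier G \<Longrightarrow> finite B \<Longrightarrow> B \<subseteq> carrier G \<Longrightarrow>
      (\<And>x. 0 \<le> h x) \<Longrightarrow> (\<And>x. x \<notin> B \<Longrightarrow> h x = 0) \<Longrightarrow>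
      L2_set (\<lambda>x. \<Sum>s\<in>S. h (s \<otimes> x)) A \<le> r * card S * L2_set h B"
  have "S \<noteq> {}" using S by auto
  then have cS: "0 < card S" using S by (simp add: card_gt_0_iff)
  define q where "q = sqrt r"
  have q: "0 < q" "q < 1" "r = q * q" using r by (auto simp: q_def)
  define \<theta> where "\<theta> = log 2 (1 / q) / card S"
  have \<theta>: "0 < \<theta>" using q cS by (simp add: \<theta>_def)
  have qpowr: "(2 ^ (card S * k)) powr (- \<theta>) = q ^ k" for k :: nat
  proof -
    have "(2 ^ (card S * k)) powr (- \<theta>) = (2::real) powr (- (log 2 (1 / q) * k))"
      using cS by (simp add: powr_realpow[symmetric] powr_powr \<theta>_def mult.commute)
    also have "\<dots> = (2 powr log 2 q) powr k"
      unfolding powr_powr using q by (simp add: log_divide)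
    also have "\<dots> = q ^ k" using q by (simp add: powr_realpow)
    finally show ?thesis .
  qed
  have "\<exists>F. finite F \<and> F \<subseteq> carrier G \<and> N \<le> card F \<and>
      kernel_bound G (\<lambda>x. of_bool (x \<in> F)) (card F powr (1 - \<theta>))" for N
  proof -
    have lim0: "(\<lambda>k. q ^ k) \<longlonglongrightarrow> 0" using q by (intro LIMSEQ_realpow_zero) auto
    have lim1: "(\<lambda>k. real k * q ^ k) \<longlonglongrightarrow> 0" using q by (intro powser_times_n_limit_0) auto
    have "(\<lambda>k. 2 * (card S * (real k * q ^ k) + q ^ k)) \<longlonglongrightarrow> 2 * (real (card S) * 0 + 0)"
      by (intro tendsto_intros lim0 lim1)
    then have ev1: "eventually (\<lambda>k. 2 * (card S * (real k * q ^ k) + q ^ k) < 1) sequentially"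
      by (rule order_tendstoD) simp
    have ev2: "eventually (\<lambda>k. q ^ k < 1 / (real N + 1)) sequentially"
      by (rule order_tendstoD[OF lim0]) simp
    obtain k where k1: "2 * (card S * (real k * q ^ k) + q ^ k) < 1" and k2: "q ^ k < 1 / (real N + 1)"
      using eventually_happens'[OF _ eventually_conj[OF ev1 ev2]] by auto
    have "kernel_bound G (\<lambda>x. real (steps G S k x)) ((r * card S) ^ k)"
      by (rule kernel_bound_steps[OF \<open>group G\<close> S(1,2) _ contr]) (use r in auto)
    then obtain F where F: "finite F" "F \<subseteq> carrier G" "F \<noteq> {}" "card F \<le> card S ^ k"
      and kb: "kernel_bound G (\<lambda>x. of_bool (x \<in> F)) (2 * (card S * k + 1) * r ^ k * card F)"
      by (rule level_set[OF \<open>group G\<close> S(1,2) \<open>S \<noteq> {}\<close> r(1)])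
    have cF: "0 < card F" using F by (simp add: card_gt_0_iff)
    have "2 * (card S * k + 1) * r ^ k = 2 * (card S * (real k * q ^ k) + q ^ k) * q ^ k"
    proof -
      have "r ^ k = q ^ k * q ^ k" by (simp only: q(3) power_mult_distrib)
      then show ?thesis by (simp add: distrib_right mult.assoc)
    qed
    also have "\<dots> \<le> 1 * q ^ k" using k1 q by (intro mult_right_mono) auto
    finally have rk: "2 * (card S * k + 1) * r ^ k \<le> q ^ k" by simp
    have kbq: "kernel_bound G (\<lambda>x. of_bool (x \<in> F)) (q ^ k * card F)"
      by (rule kernel_bound_mono[OF kb, of 1]) (use mult_right_mono[OF rk, of "real (card F)"] in simp_all)
    obtain t where "t \<in> F" using F by auto
    then have "1 \<le> q ^ k * card F" by (rule kernel_bound_ge_one[OF \<open>group G\<close> F(2) _ kbq])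
    also have "\<dots> \<le> 1 / (real N + 1) * card F" using k2 by (intro mult_right_mono) auto
    finally have N: "N \<le> card F" by (simp add: field_simps)
    have "card F \<le> (2 ^ card S) ^ k"
      by (rule order.trans[OF F(4) power_mono]) (simp_all add: less_imp_le)
    then have "real (card F) \<le> 2 ^ (card S * k)"
      unfolding power_mult[symmetric] by (simp only: of_nat_le_iff[symmetric, where ?'a = real] of_nat_power of_nat_numeral)
    then have "(2 ^ (card S * k)) powr (- \<theta>) \<le> real (card F) powr (- \<theta>)"
      using cF \<theta> by (intro powr_mono2') auto
    then have "q ^ k * card F \<le> card F powr (- \<theta>) * card F"
      unfolding qpowr by (rule mult_right_mono) simp
    also have "\<dots> = card F powr (1 - \<theta>)"
      using cF by (simp add: powr_diff powr_minus field_simps)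
    finally have "kernel_bound G (\<lambda>x. of_bool (x \<in> F)) (card F powr (1 - \<theta>))"
      by (intro kernel_bound_mono[OF kbq, of 1]) auto
    then show ?thesis using F N by blast
  qed
  then show thesis by (rule that[OF \<theta>])
qed

section \<open>The asymptotic bound\<close>

theorem theorem10:
  fixes G :: "('g, 'b) monoid_scheme"
  assumes "group G"
    and "countable (carrier G)"
    and "\<not> amenable G"
  shows "\<exists>\<delta>::real. \<delta> > 0 \<and>
    liminf (\<lambda>n. gamma_vN G n / ennreal (real n powr (1 / 2 - \<delta>))) = 0"
proof -
  obtain \<theta> :: real where \<theta>: "0 < \<theta>"
    and sets: "\<And>N. \<exists>F. finite F \<and> F \<subseteq> carrier G \<and> N \<le> card F \<and>
      kernel_bound G (\<lambda>x. of_bool (x \<in> F)) (card F powr (1 - \<theta>))"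
    using small_norm_sets[OF assms(1,3)] by blast
  \<comment> \<open>With this \<open>\<delta>\<close> the bound \<open>n\<^bsup>1/2 - \<theta>/2\<^esup>\<close> is smaller than \<open>n\<^bsup>1/2 - \<delta>\<^esup>\<close> by the factor \<open>n\<^bsup>-\<delta>\<^esup>\<close>.\<close>
  define \<delta> where "\<delta> = \<theta> / 4"
  let ?X = "\<lambda>n. gamma_vN G n / ennreal (real n powr (1 / 2 - \<delta>))"
  have small: "\<exists>n\<ge>N. ?X n \<le> ennreal (2 * real n powr (- \<delta>))" for N
  proof -
    obtain F where F: "finite F" "F \<subseteq> carrier G" "max N 1 \<le> card F"
      and kb: "kernel_bound G (\<lambda>x. of_bool (x \<in> F)) (card F powr (1 - \<theta>))"
      using sets by blast
    define n where "n = card F"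
    have n: "0 < n" "N \<le> n" using F by (auto simp: n_def)
    have "gamma_vN G n \<le> ennreal (2 * sqrt (real n powr (1 - \<theta>)))"
      unfolding n_def by (rule gamma_vN_le[OF assms(1) F(1,2) _ kb]) simp
    also have "sqrt (real n powr (1 - \<theta>)) = real n powr (- \<delta> + (1 / 2 - \<delta>))"
      by (simp add: powr_half_sqrt[symmetric] powr_powr \<delta>_def diff_divide_distrib)
    also have "\<dots> = real n powr (- \<delta>) * real n powr (1 / 2 - \<delta>)"
      by (rule powr_add)
    finally have "gamma_vN G n \<le> ennreal (2 * real n powr (- \<delta>)) * ennreal (real n powr (1 / 2 - \<delta>))"
      by (simp add: ennreal_mult'[symmetric] mult.assoc)
    then have "?X n \<le> ennreal (2 * real n powr (- \<delta>)) * ennreal (real n powr (1 / 2 - \<delta>)) / ennreal (real n powr (1 / 2 - \<delta>))"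
      by (rule divide_right_mono_ennreal)
    also have "\<dots> = ennreal (2 * real n powr (- \<delta>))"
      using n by (intro ennreal_mult_divide_eq) auto
    finally show ?thesis using n by blast
  qed
  have "liminf ?X = 0"
  proof (rule ccontr)
    assume "liminf ?X \<noteq> 0"
    then have "0 < liminf ?X" by (simp add: zero_less_iff_neq_zero)
    then obtain y where y: "0 < y" "y < liminf ?X" using dense by blast
    then obtain c where c: "y = ennreal c" "0 < c" by (cases y) (auto simp: top_unique)
    have "eventually (\<lambda>n. y < ?X n) sequentially" using y(2) less_LiminfD by blast
    moreover have "(\<lambda>n. 2 * real n powr (- \<delta>)) \<longlonglongrightarrow> 2 * 0"
      by (intro tendsto_mult_left tendsto_neg_powr filterlim_real_sequentially) (use \<theta> in \<open>simp add: \<delta>_def\<close>)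
    then have "eventually (\<lambda>n. 2 * real n powr (- \<delta>) < c) sequentially"
      by (rule order_tendstoD) (use c in simp)
    ultimately have "eventually (\<lambda>n. y < ?X n \<and> 2 * real n powr (- \<delta>) < c) sequentially"
      by (rule eventually_conj)
    then obtain N where N: "\<And>n. n \<ge> N \<Longrightarrow> y < ?X n \<and> 2 * real n powr (- \<delta>) < c"
      unfolding eventually_sequentially by blast
    obtain n where "N \<le> n" "?X n \<le> ennreal (2 * real n powr (- \<delta>))" using small by blast
    with N[of n] have "ennreal c < ennreal (2 * real n powr (- \<delta>))" "2 * real n powr (- \<delta>) < c"
      using c by auto
    then show False using c by (simp add: ennreal_less_iff)
  qed
  then show ?thesis using \<theta> by (intro exI[of _ \<delta>]) (simp add: \<delta>_def)
qed

end
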